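(* Let $\acute N$ be a radical screen transversal lightlike submanifold of a locally metallic semi-Riemannian manifold $(\breve N,\breve g,\breve J)$. Then the screen distribution $S(T\acute N)$ defines a totally geodesic foliation if and only if, for all $W,U\in\Gamma(S(T\acute N))$, there is no component of $h^s(W,\breve JU)-p\,h^s(W,U)$ in $\breve J\,ltr(T\acute N)$.
   Context: Fix positive integers $p,q$. A metallic semi-Riemannian manifold $(\breve N,\breve g,\breve J)$ is a semi-Riemannian manifold $(\breve N,\breve g)$ with a $(1,1)$-tensor field $\breve J$ such that $\breve J^2=p\breve J+qI$ and $\breve g(\breve JW,U)=\breve g(W,\breve JU)$ for all vector fields $W,U$ on $\breve N$. It is locally metallic if $\breve\nabla\breve J=0$, where $\breve\nabla$ is the Levi-Civita connection of $\breve g$. A submanifold $\acute N$ of dimension $m$ in $\breve N$ is lightlike if the metric $g$ induced from $\breve g$ is degenerate and $Rad(T\acute N)=T\acute N\cap T\acute N^{\perp}$ is a distribution of constant rank $r$, $1\le r\le m$. Fix a screen distribution $S(T\acute N)$ (non-degenerate complement of $Rad(T\acute N)$ in $T\acute N$), a screen transversal bundle $S(T\acute N^{\perp})$ (non-degenerate complement of $Rad(T\acute N)$ in $T\acute N^{\perp}$), and the associated lightlike transversal bundle $ltr(T\acute N)$: it is orthogonal to $S(T\acute N)$ and $S(T\acute N^\perp)$, and for any local basis $\{\xi_i\}$ of $Rad(T\acute N)$ it is locally spanned by $\{N_i\}$ with $\breve g(\xi_i,N_j)=\delta_{ij}$, $\breve g(N_i,N_j)=0$. With $\oplus_{ort}$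 denoting orthogonal direct sum, $T\breve N|_{\acute N}=S(T\acute N)\oplus_{ort}[Rad(T\acute N)\oplus ltr(T\acute N)]\oplus_{ort}S(T\acute N^{\perp})$. For $W,U\in\Gamma(T\acute N)$ write $\breve\nabla_WU=\nabla_WU+h^{\ell}(W,U)+h^s(W,U)$ with $\nabla_WU\in\Gamma(T\acute N)$, $h^\ell(W,U)\in\Gamma(ltr(T\acute N))$, $h^s(W,U)\in\Gamma(S(T\acute N^\perp))$. The screen distribution defines a totally geodesic foliation if $\nabla_WU\in\Gamma(S(T\acute N))$ for all $W,U\in\Gamma(S(T\acute N))$, equivalently $\breve g(\nabla_WU,N)=0$ for all such $W,U$ and all $N\in\Gamma(ltr(T\acute N))$. $\acute N$ is radical screen transversal if $\breve J\,Rad(T\acute N)\subset S(T\acute N^{\perp})$ and $\breve J\,S(T\acute N)=S(T\acute N)$. Throughout, $\breve J\,ltr(T\acute N)\subset S(T\acute N^\perp)$ as well, and $S(T\acute N^\perp)=\{\breve J Rad(T\acute N)\oplus\breve J\,ltr(T\acute N)\}\oplus_{ort}D_o$, where $D_o$ is the non-degenerate orthogonal complement. A section $X$ is said to have no component in $\breve J\,ltr(T\acute N)$ if $\breve g(X,\breve JN)=0$ for all $N\in\Gamma(ltr(T\acute N))$. *)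

theory Defs
  imports "HOL-Analysis.Analysis"
begin

section \<open>Smooth manifolds\<close>

text \<open>
  For open \<open>S\<close> this is the usual class \<open>C\<^sup>k\<close>: the iterated directional derivatives
  are required to be Frechet differentiable up to order \<open>k - 1\<close> and continuous at order \<open>k\<close>.
\<close>

primrec Ck_on ::
  "nat \<Rightarrow> 'e::real_normed_vector set \<Rightarrow> ('e \<Rightarrow> 'f::real_normed_vector) \<Rightarrow> bool" where
  "Ck_on 0 S f \<longleftrightarrow> continuous_on S f"
| "Ck_on (Suc k) S f \<longleftrightarrow> (\<forall>x\<in>S. f differentiable (at x)) \<and>
     (\<forall>v. Ck_on k S (\<lambda>x. frechet_derivative f (at x) v))"

definition smooth_on :: "'e::real_normed_vector set \<Rightarrow> ('e \<Rightarrow> 'f::real_normed_vector) \<Rightarrow> bool" where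
  "smooth_on S f \<longleftrightarrow> (\<forall>k. Ck_on k S f)"

text \<open>
  A manifold is a whole (Hausdorff, second countable) type together with an atlas; a chart is
  a pair of its domain and its coordinate map, the latter being relevant on the domain only.
\<close>

type_synonym ('a, 'e) chart = "'a set \<times> ('a \<Rightarrow> 'e)"
type_synonym ('a, 'e) atlas = "('a, 'e) chart set"

definition chart_inv :: "('a, 'e) chart \<Rightarrow> 'e \<Rightarrow> 'a" where
  "chart_inv c = inv_into (fst c) (snd c)"

definition smooth_atlas ::
  "('a::{t2_space, second_countable_topology}, 'e::euclidean_space) atlas \<Rightarrow> bool" where
  "smooth_atlas A \<longleftrightarrow>
     (\<forall>c\<in>A. open (fst c) \<and> open (snd c ` fst c) \<and>
        homeomorphism (fst c) (snd c ` fst c) (snd c) (chart_inv c)) \<and>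
     (\<Union>c\<in>A. fst c) = UNIV \<and>
     (\<forall>c\<in>A. \<forall>c'\<in>A. smooth_on (snd c ` (fst c \<inter> fst c')) (snd c' \<circ> chart_inv c))"

text \<open>
  Every point has a preferred chart, and the tangent space at \<open>x\<close> is identified with the model
  space \<open>'e\<close> by means of the preferred chart at \<open>x\<close>. Thus a vector field is a function
  \<open>'a \<Rightarrow> 'e\<close>, a fibre of a bundle of tangent vectors is a subspace of \<open>'e\<close>, and a tensor field is
  a family of multilinear maps on \<open>'e\<close>. Such a function is in general not even continuous
  as a map into \<open>'e\<close>, since the preferred chart jumps; smoothness is expressed by
  \<open>coord A c x v\<close>, the coordinates with respect to the chart \<open>c\<close> of the vector \<open>v\<close> tangent at \<open>x\<close>.
\<close>

definition chart_at :: "('a, 'e) atlas \<Rightarrow> 'a \<Rightarrow> ('a, 'e) chart" where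
  "chart_at A x = (SOME c. c \<in> A \<and> x \<in> fst c)"

definition coord ::
  "('a, 'e::euclidean_space) atlas \<Rightarrow> ('a, 'e) chart \<Rightarrow> 'a \<Rightarrow> 'e \<Rightarrow> 'e" where
  "coord A c x = frechet_derivative (snd c \<circ> chart_inv (chart_at A x)) (at (snd (chart_at A x) x))"

text \<open>The coordinate vector field of the chart \<open>c\<close> in the direction \<open>b\<close>, defined on \<open>fst c\<close>.\<close>

definition coord_field ::
  "('a, 'e::euclidean_space) atlas \<Rightarrow> ('a, 'e) chart \<Rightarrow> 'e \<Rightarrow> 'a \<Rightarrow> 'e" where
  "coord_field A c b = (\<lambda>x. frechet_derivative (snd (chart_at A x) \<circ> chart_inv c) (at (snd c x)) b)"

definition smooth_map ::
  "('b::topological_space, 'f::euclidean_space) atlas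
     \<Rightarrow> ('a::topological_space, 'e::euclidean_space) atlas \<Rightarrow> ('b \<Rightarrow> 'a) \<Rightarrow> bool" where
  "smooth_map B A \<iota> \<longleftrightarrow> continuous_on UNIV \<iota> \<and>
     (\<forall>c\<in>B. \<forall>c'\<in>A. smooth_on (snd c ` (fst c \<inter> \<iota> -` fst c')) (snd c' \<circ> \<iota> \<circ> chart_inv c))"

definition differential ::
  "('b, 'f::euclidean_space) atlas \<Rightarrow> ('a, 'e::euclidean_space) atlas \<Rightarrow> ('b \<Rightarrow> 'a) \<Rightarrow> 'b \<Rightarrow> 'f \<Rightarrow> 'e" where
  "differential B A \<iota> x =
     frechet_derivative (snd (chart_at A (\<iota> x)) \<circ> \<iota> \<circ> chart_inv (chart_at B x))
       (at (snd (chart_at B x) x))"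

definition smooth_functions ::
  "('a, 'e::euclidean_space) atlas \<Rightarrow> 'a set \<Rightarrow> ('a \<Rightarrow> real) set" where
  "smooth_functions A V = {f. \<forall>c\<in>A. smooth_on (snd c ` (fst c \<inter> V)) (f \<circ> chart_inv c)}"

definition dir_deriv ::
  "('a, 'e::euclidean_space) atlas \<Rightarrow> ('a \<Rightarrow> real) \<Rightarrow> 'a \<Rightarrow> 'e \<Rightarrow> real" where
  "dir_deriv A f x = frechet_derivative (f \<circ> chart_inv (chart_at A x)) (at (snd (chart_at A x) x))"

text \<open>
  \<open>sections_along B A \<iota> V\<close> are the smooth sections over the open set \<open>V\<close> of the pull-back by \<open>\<iota>\<close>
  of the tangent bundle of the target (the restricted tangent bundle if \<open>\<iota>\<close> is an inclusion).
\<close>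

definition sections_along ::
  "('b, 'f::euclidean_space) atlas \<Rightarrow> ('a, 'e::euclidean_space) atlas \<Rightarrow> ('b \<Rightarrow> 'a) \<Rightarrow> 'b set
     \<Rightarrow> ('b \<Rightarrow> 'e) set" where
  "sections_along B A \<iota> V = {X. \<forall>c\<in>B. \<forall>c'\<in>A.
     smooth_on (snd c ` (fst c \<inter> V \<inter> \<iota> -` fst c'))
       (\<lambda>y. coord A c' (\<iota> (chart_inv c y)) (X (chart_inv c y)))}"

definition vector_fields :: "('a, 'e::euclidean_space) atlas \<Rightarrow> 'a set \<Rightarrow> ('a \<Rightarrow> 'e) set" where
  "vector_fields A V = sections_along A A id V"


section \<open>Locally metallic semi-Riemannian manifolds\<close>

definition form_index :: "('e::euclidean_space \<Rightarrow> 'e \<Rightarrow> real) \<Rightarrow> nat" where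
  "form_index b = Max {dim F | F. subspace F \<and> (\<forall>v\<in>F. v \<noteq> 0 \<longrightarrow> b v v < 0)}"

definition nondegenerate_on :: "('e::real_vector \<Rightarrow> 'e \<Rightarrow> real) \<Rightarrow> 'e set \<Rightarrow> bool" where
  "nondegenerate_on b F \<longleftrightarrow> (\<forall>v\<in>F. (\<forall>w\<in>F. b v w = 0) \<longrightarrow> v = 0)"

definition semi_riemannian_metric ::
  "('a::topological_space, 'e::euclidean_space) atlas \<Rightarrow> ('a \<Rightarrow> 'e \<Rightarrow> 'e \<Rightarrow> real) \<Rightarrow> bool" where
  "semi_riemannian_metric A g \<longleftrightarrow>
     (\<forall>x. bilinear (g x) \<and> (\<forall>v w. g x v w = g x w v) \<and> nondegenerate_on (g x) UNIV) \<and>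
     (\<exists>\<nu>. \<forall>x. form_index (g x) = \<nu>) \<and>
     (\<forall>V X Y. open V \<longrightarrow> X \<in> vector_fields A V \<longrightarrow> Y \<in> vector_fields A V \<longrightarrow>
        (\<lambda>x. g x (X x) (Y x)) \<in> smooth_functions A V)"

definition smooth_endomorphism_field ::
  "('a::topological_space, 'e::euclidean_space) atlas \<Rightarrow> ('a \<Rightarrow> 'e \<Rightarrow> 'e) \<Rightarrow> bool" where
  "smooth_endomorphism_field A J \<longleftrightarrow>
     (\<forall>x. linear (J x)) \<and>
     (\<forall>V X. open V \<longrightarrow> X \<in> vector_fields A V \<longrightarrow> (\<lambda>x. J x (X x)) \<in> vector_fields A V)"

text \<open>
  In \<open>D x v Y\<close> the vector \<open>v\<close> is tangent at \<open>x\<close> and \<open>Y\<close> is a vector field which is smooth on some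
  open neighbourhood of \<open>x\<close>; the value is a vector tangent at \<open>x\<close>.
\<close>

type_synonym ('a, 'e) connection = "'a \<Rightarrow> 'e \<Rightarrow> ('a \<Rightarrow> 'e) \<Rightarrow> 'e"

definition affine_connection ::
  "('a::topological_space, 'e::euclidean_space) atlas \<Rightarrow> ('a, 'e) connection \<Rightarrow> bool" where
  "affine_connection A D \<longleftrightarrow>
     (\<forall>V Y. open V \<longrightarrow> Y \<in> vector_fields A V \<longrightarrow>
        (\<forall>x\<in>V. linear (\<lambda>v. D x v Y)) \<and>
        (\<forall>x\<in>V. \<forall>v. \<forall>Z. (\<forall>y\<in>V. Z y = Y y) \<longrightarrow> D x v Z = D x v Y) \<and>
        (\<forall>x\<in>V. \<forall>v. \<forall>Z\<in>vector_fields A V. D x v (\<lambda>y. Y y + Z y) = D x v Y + D x v Z) \<and>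
        (\<forall>x\<in>V. \<forall>v. \<forall>f\<in>smooth_functions A V.
           D x v (\<lambda>y. f y *\<^sub>R Y y) = dir_deriv A f x v *\<^sub>R Y x + f x *\<^sub>R D x v Y) \<and>
        (\<forall>X\<in>vector_fields A V. (\<lambda>x. D x (X x) Y) \<in> vector_fields A V))"

text \<open>
  The first conjunct after \<^term>\<open>affine_connection A D\<close> is vanishing of the torsion,
  \<open>D\<^sub>X Y - D\<^sub>Y X = [X, Y]\<close>, where the Lie bracket is given by \<open>[X, Y] f = X (Y f) - Y (X f)\<close>.
\<close>

definition levi_civita ::
  "('a::topological_space, 'e::euclidean_space) atlas \<Rightarrow> ('a \<Rightarrow> 'e \<Rightarrow> 'e \<Rightarrow> real)
     \<Rightarrow> ('a, 'e) connection \<Rightarrow> bool" where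
  "levi_civita A g D \<longleftrightarrow> affine_connection A D \<and>
     (\<forall>V. open V \<longrightarrow> (\<forall>X\<in>vector_fields A V. \<forall>Y\<in>vector_fields A V. \<forall>f\<in>smooth_functions A V. \<forall>x\<in>V.
        dir_deriv A f x (D x (X x) Y - D x (Y x) X) =
          dir_deriv A (\<lambda>y. dir_deriv A f y (Y y)) x (X x) -
          dir_deriv A (\<lambda>y. dir_deriv A f y (X y)) x (Y x))) \<and>
     (\<forall>V. open V \<longrightarrow> (\<forall>Y\<in>vector_fields A V. \<forall>Z\<in>vector_fields A V. \<forall>x\<in>V. \<forall>v.
        dir_deriv A (\<lambda>y. g y (Y y) (Z y)) x v = g x (D x v Y) (Z x) + g x (Y x) (D x v Z)))"

definition metallic_manifold ::
  "nat \<Rightarrow> nat \<Rightarrow> ('a::{t2_space, second_countable_topology}, 'e::euclidean_space) atlas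
     \<Rightarrow> ('a \<Rightarrow> 'e \<Rightarrow> 'e \<Rightarrow> real) \<Rightarrow> ('a \<Rightarrow> 'e \<Rightarrow> 'e) \<Rightarrow> bool" where
  "metallic_manifold p q A g J \<longleftrightarrow>
     smooth_atlas A \<and> semi_riemannian_metric A g \<and> smooth_endomorphism_field A J \<and>
     (\<forall>x v. J x (J x v) = real p *\<^sub>R J x v + real q *\<^sub>R v) \<and>
     (\<forall>x v w. g x (J x v) w = g x v (J x w))"

definition parallel_endomorphism ::
  "('a::topological_space, 'e::euclidean_space) atlas \<Rightarrow> ('a, 'e) connection
     \<Rightarrow> ('a \<Rightarrow> 'e \<Rightarrow> 'e) \<Rightarrow> bool" where
  "parallel_endomorphism A D J \<longleftrightarrow>
     (\<forall>V. open V \<longrightarrow> (\<forall>Y\<in>vector_fields A V. \<forall>x\<in>V. \<forall>v.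
        D x v (\<lambda>y. J y (Y y)) - J x (D x v Y) = 0))"

definition locally_metallic_manifold ::
  "nat \<Rightarrow> nat \<Rightarrow> ('a::{t2_space, second_countable_topology}, 'e::euclidean_space) atlas
     \<Rightarrow> ('a \<Rightarrow> 'e \<Rightarrow> 'e \<Rightarrow> real) \<Rightarrow> ('a \<Rightarrow> 'e \<Rightarrow> 'e) \<Rightarrow> ('a, 'e) connection \<Rightarrow> bool" where
  "locally_metallic_manifold p q A g J D \<longleftrightarrow>
     metallic_manifold p q A g J \<and> levi_civita A g D \<and> parallel_endomorphism A D J"


section \<open>Lightlike submanifolds\<close>

text \<open>
  The submanifold is a manifold with atlas \<open>B\<close> and an injective immersion \<open>\<iota>\<close>. All bundles over it
  are subbundles of the restricted ambient tangent bundle: families of subspaces \<open>E x\<close>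
  of the ambient tangent space at \<open>\<iota> x\<close>. Likewise tangent vectors of the submanifold are
  represented by their images under the differential of \<open>\<iota>\<close>.
\<close>

definition immersed_submanifold ::
  "('b::{t2_space, second_countable_topology}, 'f::euclidean_space) atlas
     \<Rightarrow> ('a::{t2_space, second_countable_topology}, 'e::euclidean_space) atlas
     \<Rightarrow> ('b \<Rightarrow> 'a) \<Rightarrow> bool" where
  "immersed_submanifold B A \<iota> \<longleftrightarrow>
     smooth_atlas B \<and> smooth_map B A \<iota> \<and> inj \<iota> \<and> (\<forall>x. inj (differential B A \<iota> x))"

definition tangent_bundle ::
  "('b, 'f::euclidean_space) atlas \<Rightarrow> ('a, 'e::euclidean_space) atlas \<Rightarrow> ('b \<Rightarrow> 'a) \<Rightarrow> 'b \<Rightarrow> 'e set" where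
  "tangent_bundle B A \<iota> x = range (differential B A \<iota> x)"

definition normal_bundle ::
  "('b, 'f::euclidean_space) atlas \<Rightarrow> ('a, 'e::euclidean_space) atlas \<Rightarrow> ('b \<Rightarrow> 'a)
     \<Rightarrow> ('a \<Rightarrow> 'e \<Rightarrow> 'e \<Rightarrow> real) \<Rightarrow> 'b \<Rightarrow> 'e set" where
  "normal_bundle B A \<iota> g x = {v. \<forall>w\<in>tangent_bundle B A \<iota> x. g (\<iota> x) v w = 0}"

definition radical ::
  "('b, 'f::euclidean_space) atlas \<Rightarrow> ('a, 'e::euclidean_space) atlas \<Rightarrow> ('b \<Rightarrow> 'a)
     \<Rightarrow> ('a \<Rightarrow> 'e \<Rightarrow> 'e \<Rightarrow> real) \<Rightarrow> 'b \<Rightarrow> 'e set" where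
  "radical B A \<iota> g x = tangent_bundle B A \<iota> x \<inter> normal_bundle B A \<iota> g x"

definition local_frame ::
  "('b, 'f::euclidean_space) atlas \<Rightarrow> ('a, 'e::euclidean_space) atlas \<Rightarrow> ('b \<Rightarrow> 'a)
     \<Rightarrow> nat \<Rightarrow> ('b \<Rightarrow> 'e set) \<Rightarrow> 'b set \<Rightarrow> (nat \<Rightarrow> 'b \<Rightarrow> 'e) \<Rightarrow> bool" where
  "local_frame B A \<iota> k E V \<xi> \<longleftrightarrow>
     (\<forall>i<k. \<xi> i \<in> sections_along B A \<iota> V) \<and>
     (\<forall>x\<in>V. inj_on (\<lambda>i. \<xi> i x) {..<k} \<and> independent ((\<lambda>i. \<xi> i x) ` {..<k}) \<and>
        span ((\<lambda>i. \<xi> i x) ` {..<k}) = E x)"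

definition smooth_subbundle ::
  "('b::topological_space, 'f::euclidean_space) atlas \<Rightarrow> ('a, 'e::euclidean_space) atlas
     \<Rightarrow> ('b \<Rightarrow> 'a) \<Rightarrow> nat \<Rightarrow> ('b \<Rightarrow> 'e set) \<Rightarrow> bool" where
  "smooth_subbundle B A \<iota> k E \<longleftrightarrow>
     (\<forall>x. \<exists>V \<xi>. open V \<and> x \<in> V \<and> local_frame B A \<iota> k E V \<xi>)"

definition sections ::
  "('b, 'f::euclidean_space) atlas \<Rightarrow> ('a, 'e::euclidean_space) atlas \<Rightarrow> ('b \<Rightarrow> 'a)
     \<Rightarrow> ('b \<Rightarrow> 'e set) \<Rightarrow> ('b \<Rightarrow> 'e) set" where
  "sections B A \<iota> E = {X \<in> sections_along B A \<iota> UNIV. \<forall>x. X x \<in> E x}"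

definition direct_sum :: "'e::real_vector set \<Rightarrow> 'e set \<Rightarrow> 'e set \<Rightarrow> bool" where
  "direct_sum E F G \<longleftrightarrow> E \<inter> F = {0} \<and> {u + v | u v. u \<in> E \<and> v \<in> F} = G"

definition orthogonal_sets :: "('e \<Rightarrow> 'e \<Rightarrow> real) \<Rightarrow> 'e set \<Rightarrow> 'e set \<Rightarrow> bool" where
  "orthogonal_sets b E F \<longleftrightarrow> (\<forall>u\<in>E. \<forall>v\<in>F. b u v = 0)"

text \<open>Degeneracy of the induced metric is the condition \<open>1 \<le> r\<close>.\<close>

definition lightlike_submanifold ::
  "('b::{t2_space, second_countable_topology}, 'f::euclidean_space) atlas
     \<Rightarrow> ('a::{t2_space, second_countable_topology}, 'e::euclidean_space) atlas
     \<Rightarrow> ('b \<Rightarrow> 'a) \<Rightarrow> ('a \<Rightarrow> 'e \<Rightarrow> 'e \<Rightarrow> real) \<Rightarrow> nat \<Rightarrow> bool" where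
  "lightlike_submanifold B A \<iota> g r \<longleftrightarrow>
     immersed_submanifold B A \<iota> \<and> 1 \<le> r \<and> r \<le> DIM('f) \<and>
     smooth_subbundle B A \<iota> r (radical B A \<iota> g)"

definition screen_distribution ::
  "('b::topological_space, 'f::euclidean_space) atlas \<Rightarrow> ('a, 'e::euclidean_space) atlas
     \<Rightarrow> ('b \<Rightarrow> 'a) \<Rightarrow> ('a \<Rightarrow> 'e \<Rightarrow> 'e \<Rightarrow> real) \<Rightarrow> ('b \<Rightarrow> 'e set) \<Rightarrow> bool" where
  "screen_distribution B A \<iota> g S \<longleftrightarrow>
     (\<exists>k. smooth_subbundle B A \<iota> k S) \<and>
     (\<forall>x. nondegenerate_on (g (\<iota> x)) (S x) \<and>
        direct_sum (radical B A \<iota> g x) (S x) (tangent_bundle B A \<iota> x))"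

definition screen_transversal_bundle ::
  "('b::topological_space, 'f::euclidean_space) atlas \<Rightarrow> ('a, 'e::euclidean_space) atlas
     \<Rightarrow> ('b \<Rightarrow> 'a) \<Rightarrow> ('a \<Rightarrow> 'e \<Rightarrow> 'e \<Rightarrow> real) \<Rightarrow> ('b \<Rightarrow> 'e set) \<Rightarrow> bool" where
  "screen_transversal_bundle B A \<iota> g P \<longleftrightarrow>
     (\<exists>k. smooth_subbundle B A \<iota> k P) \<and>
     (\<forall>x. nondegenerate_on (g (\<iota> x)) (P x) \<and>
        direct_sum (radical B A \<iota> g x) (P x) (normal_bundle B A \<iota> g x))"

definition lightlike_transversal_bundle ::
  "('b::topological_space, 'f::euclidean_space) atlas \<Rightarrow> ('a, 'e::euclidean_space) atlas
     \<Rightarrow> ('b \<Rightarrow> 'a) \<Rightarrow> ('a \<Rightarrow> 'e \<Rightarrow> 'e \<Rightarrow> real) \<Rightarrow> nat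
     \<Rightarrow> ('b \<Rightarrow> 'e set) \<Rightarrow> ('b \<Rightarrow> 'e set) \<Rightarrow> ('b \<Rightarrow> 'e set) \<Rightarrow> bool" where
  "lightlike_transversal_bundle B A \<iota> g r S P L \<longleftrightarrow>
     smooth_subbundle B A \<iota> r L \<and>
     (\<forall>x. orthogonal_sets (g (\<iota> x)) (L x) (S x) \<and> orthogonal_sets (g (\<iota> x)) (L x) (P x)) \<and>
     (\<forall>V \<xi>. open V \<longrightarrow> local_frame B A \<iota> r (radical B A \<iota> g) V \<xi> \<longrightarrow>
        (\<forall>x\<in>V. \<exists>V' N. open V' \<and> x \<in> V' \<and> V' \<subseteq> V \<and> local_frame B A \<iota> r L V' N \<and>
           (\<forall>y\<in>V'. \<forall>i<r. \<forall>j<r. g (\<iota> y) (\<xi> i y) (N j y) = (if i = j then 1 else 0) \<and>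
              g (\<iota> y) (N i y) (N j y) = 0)))"

text \<open>
  The ambient covariant derivative, at \<open>x\<close>, of a section \<open>U\<close> of the restricted ambient
  tangent bundle in the direction of a section \<open>W\<close> of the tangent bundle of the submanifold.
  If \<open>U\<close> has components \<open>U\<^sup>b\<close> in the coordinate frame \<open>\<partial>\<^sub>b\<close> of the ambient preferred chart at \<open>\<iota> x\<close>,
  it is \<open>\<Sum>b. W(U\<^sup>b) \<partial>\<^sub>b + U\<^sup>b D\<^sub>W \<partial>\<^sub>b\<close>, as forced by the Leibniz rule;
  at \<open>\<iota> x\<close> itself, \<open>\<partial>\<^sub>b\<close> is \<open>b\<close> and the components of \<open>U x\<close> are those of the vector \<open>U x\<close> in \<open>'e\<close>.
\<close>

definition conn_along ::
  "('b, 'f::euclidean_space) atlas \<Rightarrow> ('a, 'e::euclidean_space) atlas \<Rightarrow> ('b \<Rightarrow> 'a)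
     \<Rightarrow> ('a, 'e) connection \<Rightarrow> ('b \<Rightarrow> 'e) \<Rightarrow> ('b \<Rightarrow> 'e) \<Rightarrow> 'b \<Rightarrow> 'e" where
  "conn_along B A \<iota> D W U x =
     (let c = chart_at A (\<iota> x); d = chart_at B x; w = inv (differential B A \<iota> x) (W x) in
        frechet_derivative (\<lambda>y. coord A c (\<iota> (chart_inv d y)) (U (chart_inv d y))) (at (snd d x)) w
        + (\<Sum>b\<in>Basis. (U x \<bullet> b) *\<^sub>R D (\<iota> x) (W x) (coord_field A c b)))"

text \<open>
  The tangential and screen transversal components of the ambient covariant derivative with
  respect to the direct sum decomposition of the restricted ambient tangent bundle into
  \<open>tangent_bundle B A \<iota>\<close>, \<open>L\<close> (lightlike transversal) and \<open>P\<close> (screen transversal). That these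
  three are complementary is a consequence of the defining properties of \<open>L\<close> and \<open>P\<close>.
\<close>

definition induced_conn ::
  "('b, 'f::euclidean_space) atlas \<Rightarrow> ('a, 'e::euclidean_space) atlas \<Rightarrow> ('b \<Rightarrow> 'a)
     \<Rightarrow> ('a, 'e) connection \<Rightarrow> ('b \<Rightarrow> 'e set) \<Rightarrow> ('b \<Rightarrow> 'e set)
     \<Rightarrow> ('b \<Rightarrow> 'e) \<Rightarrow> ('b \<Rightarrow> 'e) \<Rightarrow> 'b \<Rightarrow> 'e" where
  "induced_conn B A \<iota> D L P W U x =
     (THE t. t \<in> tangent_bundle B A \<iota> x \<and>
        (\<exists>l\<in>L x. \<exists>s\<in>P x. conn_along B A \<iota> D W U x = t + l + s))"

definition h_screen ::
  "('b, 'f::euclidean_space) atlas \<Rightarrow> ('a, 'e::euclidean_space) atlas \<Rightarrow> ('b \<Rightarrow> 'a)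
     \<Rightarrow> ('a, 'e) connection \<Rightarrow> ('b \<Rightarrow> 'e set) \<Rightarrow> ('b \<Rightarrow> 'e set)
     \<Rightarrow> ('b \<Rightarrow> 'e) \<Rightarrow> ('b \<Rightarrow> 'e) \<Rightarrow> 'b \<Rightarrow> 'e" where
  "h_screen B A \<iota> D L P W U x =
     (THE s. s \<in> P x \<and>
        (\<exists>t\<in>tangent_bundle B A \<iota> x. \<exists>l\<in>L x. conn_along B A \<iota> D W U x = t + l + s))"

text \<open>
  Since the induced covariant derivative of smooth sections is smooth, being a section of \<open>S\<close>
  is the pointwise condition below.
\<close>

definition totally_geodesic_screen ::
  "('b, 'f::euclidean_space) atlas \<Rightarrow> ('a, 'e::euclidean_space) atlas \<Rightarrow> ('b \<Rightarrow> 'a)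
     \<Rightarrow> ('a, 'e) connection \<Rightarrow> ('b \<Rightarrow> 'e set) \<Rightarrow> ('b \<Rightarrow> 'e set) \<Rightarrow> ('b \<Rightarrow> 'e set) \<Rightarrow> bool" where
  "totally_geodesic_screen B A \<iota> D S L P \<longleftrightarrow>
     (\<forall>W\<in>sections B A \<iota> S. \<forall>U\<in>sections B A \<iota> S. \<forall>x. induced_conn B A \<iota> D L P W U x \<in> S x)"

definition radical_screen_transversal ::
  "('b, 'f::euclidean_space) atlas \<Rightarrow> ('a, 'e::euclidean_space) atlas \<Rightarrow> ('b \<Rightarrow> 'a)
     \<Rightarrow> ('a \<Rightarrow> 'e \<Rightarrow> 'e \<Rightarrow> real) \<Rightarrow> ('a \<Rightarrow> 'e \<Rightarrow> 'e) \<Rightarrow> ('b \<Rightarrow> 'e set) \<Rightarrow> ('b \<Rightarrow> 'e set) \<Rightarrow> bool" where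
  "radical_screen_transversal B A \<iota> g J S P \<longleftrightarrow>
     (\<forall>x. J (\<iota> x) ` radical B A \<iota> g x \<subseteq> P x \<and> J (\<iota> x) ` S x = S x)"

text \<open>
  The standing assumption on \<open>J ltr\<close> and the decomposition of the screen transversal bundle;
  \<open>K\<close> is the fibre of \<open>J Rad \<oplus> J ltr\<close> and \<open>D\<^sub>o\<close> its orthogonal complement in \<open>P x\<close>.
\<close>

definition screen_transversal_splitting ::
  "('b, 'f::euclidean_space) atlas \<Rightarrow> ('a, 'e::euclidean_space) atlas \<Rightarrow> ('b \<Rightarrow> 'a)
     \<Rightarrow> ('a \<Rightarrow> 'e \<Rightarrow> 'e \<Rightarrow> real) \<Rightarrow> ('a \<Rightarrow> 'e \<Rightarrow> 'e) \<Rightarrow> ('b \<Rightarrow> 'e set) \<Rightarrow> ('b \<Rightarrow> 'e set) \<Rightarrow> bool" where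
  "screen_transversal_splitting B A \<iota> g J L P \<longleftrightarrow>
     (\<forall>x. J (\<iota> x) ` L x \<subseteq> P x \<and>
        (\<exists>K D\<^sub>o. direct_sum (J (\<iota> x) ` radical B A \<iota> g x) (J (\<iota> x) ` L x) K \<and>
           D\<^sub>o = {v \<in> P x. \<forall>u\<in>K. g (\<iota> x) u v = 0} \<and>
           nondegenerate_on (g (\<iota> x)) D\<^sub>o \<and> direct_sum K D\<^sub>o (P x)))"

definition no_component_in_J_ltr ::
  "('b, 'f::euclidean_space) atlas \<Rightarrow> ('a, 'e::euclidean_space) atlas \<Rightarrow> ('b \<Rightarrow> 'a)
     \<Rightarrow> ('a \<Rightarrow> 'e \<Rightarrow> 'e \<Rightarrow> real) \<Rightarrow> ('a \<Rightarrow> 'e \<Rightarrow> 'e) \<Rightarrow> ('b \<Rightarrow> 'e set) \<Rightarrow> ('b \<Rightarrow> 'e) \<Rightarrow> bool" where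
  "no_component_in_J_ltr B A \<iota> g J L X \<longleftrightarrow>
     (\<forall>N\<in>sections B A \<iota> L. \<forall>x. g (\<iota> x) (X x) (J (\<iota> x) (N x)) = 0)"

end

theory Submission
  imports Defs
begin

text \<open>
  Write \<open>\<nabla>\<close> for the ambient connection along the submanifold. Since \<open>J\<close> is parallel,
  \<open>\<nabla>\<^sub>W (J U) = J (\<nabla>\<^sub>W U)\<close>. For a vector \<open>n\<close> of the lightlike transversal bundle \<open>L\<close>, the vector \<open>J n\<close>
  lies in the screen transversal bundle \<open>P\<close>, which is orthogonal to the tangent bundle
  and to \<open>L\<close>; hence pairing an ambient derivative with \<open>J n\<close> sees its \<open>h\<^sup>s\<close> part only. As \<open>J\<close> is
  self-adjoint and \<open>J\<^sup>2 = p J + q I\<close>,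
  \<open>g (h\<^sup>s(W, J U), J n) = g (J (\<nabla>\<^sub>W U), J n) = p g (\<nabla>\<^sub>W U, J n) + q g (\<nabla>\<^sub>W U, n)\<close>, and therefore
  \<open>g (h\<^sup>s(W, J U) - p h\<^sup>s(W, U), J n) = q g (t, n)\<close>, where \<open>t\<close> is the tangential part of
  \<open>\<nabla>\<^sub>W U\<close>: its other two parts are orthogonal to \<open>n\<close>, because \<open>L\<close> is isotropic and orthogonal to \<open>P\<close>
  (lemma \<open>screen_component_pairing\<close>). A tangent vector lies in the screen distribution iff it
  is orthogonal to \<open>L\<close> (lemma \<open>mem_screen_iff\<close>), because \<open>L\<close> is dual to the radical; since \<open>q \<noteq> 0\<close>,
  the equivalence follows.

  Three facts behind this sketch need work. The first is \<open>\<nabla>\<^sub>W (J U) = J (\<nabla>\<^sub>W U)\<close> for a vector field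
  \<open>U\<close> that is defined along the submanifold only: lemma \<open>conn_along_endomorphism\<close> derives it
  from the parallelism of \<open>J\<close> on the ambient coordinate fields, by expanding \<open>J U\<close> in
  those fields. The second is that the tangent bundle, \<open>L\<close> and \<open>P\<close> are complementary
  (lemmas \<open>decomposition\<close> and \<open>decomposition_unique\<close>), so that the components of the ambient derivative
  are well defined. The third is that every vector of \<open>L\<close> is a value of a global section of \<open>L\<close>
  (lemma \<open>section_through_vector\<close>), since the absence of a component in \<open>J L\<close> is a statement about global
  sections; this takes a smooth bump function.
\<close>

section \<open>Calculus of k times continuously differentiable functions\<close>

lemma Ck_on_Suc_imp: "Ck_on (Suc k) S f \<Longrightarrow> Ck_on k S f"
proof (induction k arbitrary: f)
  case 0
  then show ?case
    by (auto intro!: continuous_at_imp_continuous_on differentiable_imp_continuous_within)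
next
  case (Suc k)
  then show ?case by (metis Ck_on.simps(2))
qed

lemma Ck_on_subset: "Ck_on k S f \<Longrightarrow> S' \<subseteq> S \<Longrightarrow> Ck_on k S' f"
  by (induction k arbitrary: f) (auto intro: continuous_on_subset)

lemma frechet_derivative_cong_open:
  assumes "open S" "x \<in> S" "\<And>y. y \<in> S \<Longrightarrow> f y = g y"
  shows "frechet_derivative f (at x) = frechet_derivative g (at x)"
proof -
  have "(f has_derivative F) (at x) \<longleftrightarrow> (g has_derivative F) (at x)" for F
    using assms by (metis has_derivative_transform_within_open)
  then show ?thesis by (simp add: frechet_derivative_def)
qed

lemma differentiable_cong_open:
  assumes "open S" "x \<in> S" "\<And>y. y \<in> S \<Longrightarrow> f y = g y"
  shows "f differentiable (at x) \<longleftrightarrow> g differentiable (at x)"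
  using assms unfolding differentiable_def
  by (metis has_derivative_transform_within_open)

lemma Ck_on_cong:
  assumes "open S" "\<And>y. y \<in> S \<Longrightarrow> f y = g y" "Ck_on k S f"
  shows "Ck_on k S g"
  using assms(2,3)
proof (induction k arbitrary: f g)
  case 0
  then show ?case by (auto cong: continuous_on_cong)
next
  case (Suc k)
  have "frechet_derivative f (at x) v = frechet_derivative g (at x) v" if "x \<in> S" for x v
    using frechet_derivative_cong_open[OF assms(1) that] Suc.prems(1) by metis
  with Suc show ?case
    using differentiable_cong_open[OF assms(1)] by (metis (no_types, lifting) Ck_on.simps(2))
qed

text \<open>The order of differentiability is a local property.\<close>

lemma Ck_on_Union:
  assumes "\<And>T. T \<in> \<F> \<Longrightarrow> open T" "\<And>T. T \<in> \<F> \<Longrightarrow> Ck_on k T f"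
  shows "Ck_on k (\<Union>\<F>) f"
  using assms(2)
proof (induction k arbitrary: f)
  case 0
  then show ?case using continuous_on_open_Union[of \<F> f] assms(1) by simp
qed auto

text \<open>
  The recursive clause in terms of any family \<open>f'\<close> of derivatives instead of the
  chosen one.
\<close>

lemma Ck_on_SucI:
  assumes "open S" "\<And>x. x \<in> S \<Longrightarrow> (f has_derivative f' x) (at x)"
    and "\<And>v. Ck_on k S (\<lambda>x. f' x v)"
  shows "Ck_on (Suc k) S f"
proof -
  have "f' x v = frechet_derivative f (at x) v" if "x \<in> S" for x v
    using frechet_derivative_at[OF assms(2)[OF that]] by simp
  with assms show ?thesis
    by (auto simp: differentiable_def intro: Ck_on_cong[where f = "\<lambda>x. f' x _"])
qed

lemma Ck_on_Suc_derivative: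
  "Ck_on (Suc k) S f \<Longrightarrow> x \<in> S \<Longrightarrow> (f has_derivative frechet_derivative f (at x)) (at x)"
  by (simp add: frechet_derivative_works[symmetric])

lemma Ck_on_const: "open S \<Longrightarrow> Ck_on k S (\<lambda>x. a)"
proof (induction k arbitrary: a)
  case (Suc k)
  then show ?case by (intro Ck_on_SucI[where f' = "\<lambda>x v. 0"]) auto
qed simp

lemma Ck_on_linear:
  assumes "open S" "bounded_linear h" "Ck_on k S f"
  shows "Ck_on k S (\<lambda>x. h (f x))"
  using assms(3)
proof (induction k arbitrary: f)
  case 0
  then show ?case using assms(2) by (simp add: bounded_linear.continuous_on)
next
  case (Suc k)
  show ?case
  proof (rule Ck_on_SucI[OF assms(1)])
    show "((\<lambda>x. h (f x)) has_derivative (\<lambda>v. h (frechet_derivative f (at x) v))) (at x)"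
      if "x \<in> S" for x
      using Ck_on_Suc_derivative[OF Suc.prems that] by (rule bounded_linear.has_derivative[OF assms(2)])
  qed (use Suc in auto)
qed

lemma Ck_on_add:
  assumes "open S" "Ck_on k S f" "Ck_on k S g"
  shows "Ck_on k S (\<lambda>x. f x + g x)"
  using assms(2,3)
proof (induction k arbitrary: f g)
  case 0
  then show ?case by (simp add: continuous_on_add)
next
  case (Suc k)
  show ?case
    by (rule Ck_on_SucI[OF assms(1) has_derivative_add[OF Ck_on_Suc_derivative Ck_on_Suc_derivative]])
      (use Suc in auto)
qed

lemma Ck_on_sum:
  "open S \<Longrightarrow> (\<And>i. i \<in> I \<Longrightarrow> Ck_on k S (f i)) \<Longrightarrow> Ck_on k S (\<lambda>x. \<Sum>i\<in>I. f i x)"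
  by (induction I rule: infinite_finite_induct) (auto intro: Ck_on_const Ck_on_add)

lemma Ck_on_bilinear:
  assumes "open S" "bounded_bilinear h" "Ck_on k S f" "Ck_on k S g"
  shows "Ck_on k S (\<lambda>x. h (f x) (g x))"
  using assms(3,4)
proof (induction k arbitrary: f g)
  case 0
  then show ?case using assms(2) by (simp add: bounded_bilinear.continuous_on)
next
  case (Suc k)
  show ?case
  proof (rule Ck_on_SucI[OF assms(1)])
    show "((\<lambda>x. h (f x) (g x)) has_derivative
        (\<lambda>v. h (f x) (frechet_derivative g (at x) v) + h (frechet_derivative f (at x) v) (g x))) (at x)"
      if "x \<in> S" for x
      using Ck_on_Suc_derivative[OF Suc.prems(1) that] Ck_on_Suc_derivative[OF Suc.prems(2) that]
      by (rule bounded_bilinear.FDERIV[OF assms(2)])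
    show "Ck_on k S (\<lambda>x. h (f x) (frechet_derivative g (at x) v) + h (frechet_derivative f (at x) v) (g x))" for v
      using Suc.prems Suc.prems[THEN Ck_on_Suc_imp] by (intro Ck_on_add assms(1) Suc.IH) auto
  qed
qed

lemma Ck_on_scaleR:
  "open S \<Longrightarrow> Ck_on k S f \<Longrightarrow> Ck_on k S g \<Longrightarrow> Ck_on k S (\<lambda>x. f x *\<^sub>R g x)"
  by (rule Ck_on_bilinear[OF _ bounded_bilinear_scaleR])

text \<open>
  By the chain rule the directional derivative of the composition is not of the form
  \<open>h \<circ> g\<close>, because the direction \<open>g'(x) v\<close> depends on \<open>x\<close>. Expanding this direction in the standard
  basis makes the induction go through.
\<close>

lemma Ck_on_compose:
  fixes f :: "'e::euclidean_space \<Rightarrow> 'f::real_normed_vector"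
  assumes "open S" "open T" "g ` S \<subseteq> T" "Ck_on k S g" "Ck_on k T f"
  shows "Ck_on k S (\<lambda>x. f (g x))"
  using assms(4,5)
proof (induction k arbitrary: f)
  case 0
  then show ?case using assms(3) by (auto intro: continuous_on_compose2)
next
  case (Suc k)
  let ?f' = "\<lambda>x. frechet_derivative f (at (g x))" and ?g' = "\<lambda>x. frechet_derivative g (at x)"
  show ?case
  proof (rule Ck_on_SucI[OF assms(1)])
    fix x assume "x \<in> S"
    then have f: "(f has_derivative ?f' x) (at (g x))" and g: "(g has_derivative ?g' x) (at x)"
      using Ck_on_Suc_derivative[OF Suc.prems(1)] Ck_on_Suc_derivative[OF Suc.prems(2)] assms(3) by auto
    have "?f' x (?g' x v) = (\<Sum>b\<in>Basis. (?g' x v \<bullet> b) *\<^sub>R ?f' x b)" for v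
    proof -
      have lin: "linear (?f' x)" using f has_derivative_linear by blast
      have "?f' x (?g' x v) = ?f' x (\<Sum>b\<in>Basis. (?g' x v \<bullet> b) *\<^sub>R b)" by (simp add: euclidean_representation)
      then show ?thesis by (simp add: linear_sum[OF lin] linear_cmul[OF lin])
    qed
    with has_derivative_compose[OF g f]
    show "((\<lambda>x. f (g x)) has_derivative (\<lambda>v. \<Sum>b\<in>Basis. (?g' x v \<bullet> b) *\<^sub>R ?f' x b)) (at x)"
      by simp
  next
    have "Ck_on k S (\<lambda>x. ?f' x b)" for b
      using Suc.IH[of "\<lambda>y. frechet_derivative f (at y) b"] Suc.prems Ck_on_Suc_imp by auto
    moreover have "Ck_on k S (\<lambda>x. ?g' x v \<bullet> b)" for v b
      using Suc.prems(1) by (intro Ck_on_linear[OF assms(1) bounded_linear_inner_left]) auto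
    ultimately show "Ck_on k S (\<lambda>x. \<Sum>b\<in>Basis. (?g' x v \<bullet> b) *\<^sub>R ?f' x b)" for v
      by (intro Ck_on_sum Ck_on_scaleR assms(1))
  qed
qed

section \<open>A flat function on the real line\<close>

text \<open>
  The function \<open>t\<^sup>-\<^sup>n exp(-1/t)\<close>, extended by \<open>0\<close> to \<open>t \<le> 0\<close>. The case \<open>n = 0\<close> is the usual building
  block of bump functions; the other values of \<open>n\<close> make the family closed under
  differentiation up to linear combinations.
\<close>

definition flat_fun :: "nat \<Rightarrow> real \<Rightarrow> real" where
  "flat_fun n t = (if t > 0 then inverse t ^ n * exp (- inverse t) else 0)"

lemma flat_fun_tendsto_0: "(flat_fun n \<longlongrightarrow> 0) (at 0)"
proof -
  have "((\<lambda>s::real. s ^ n / exp s) \<longlongrightarrow> 0) at_top" by (rule tendsto_power_div_exp_0)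
  then have "((\<lambda>t::real. inverse t ^ n / exp (inverse t)) \<longlongrightarrow> 0) (at_right 0)"
    by (rule filterlim_compose[OF _ filterlim_inverse_at_top_right])
  then have "(flat_fun n \<longlongrightarrow> 0) (at_right 0)"
    by (rule tendsto_cong[THEN iffD1, rotated])
      (auto simp: flat_fun_def eventually_at_right_less exp_minus divide_inverse
        intro: eventually_mono[OF eventually_at_right_less])
  moreover have "(flat_fun n \<longlongrightarrow> 0) (at_left 0)"
    by (rule tendsto_eventually)
      (auto simp: flat_fun_def intro!: eventually_at_leftI[of "-1"])
  ultimately show ?thesis by (simp add: filterlim_split_at)
qed

lemma flat_fun_has_derivative:
  "(flat_fun n has_field_derivative (flat_fun (n + 2) t - real n * flat_fun (n + 1) t)) (at t)"
proof (cases t "0::real" rule: linorder_cases)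
  case less
  have "((\<lambda>_. 0) has_field_derivative 0) (at t)" by simp
  then have "(flat_fun n has_field_derivative 0) (at t)"
    by (rule has_field_derivative_transform_within_open[where S = "{..<0}"]) (use less in \<open>auto simp: flat_fun_def\<close>)
  with less show ?thesis by (simp add: flat_fun_def)
next
  case equal
  \<comment> \<open>The difference quotient at \<open>0\<close> is the next function of the family.\<close>
  have "((\<lambda>h. (flat_fun n (0 + h) - flat_fun n 0) / h) \<longlongrightarrow> 0) (at 0)"
    by (rule tendsto_cong[THEN iffD1, OF _ flat_fun_tendsto_0[of "Suc n"]])
      (auto simp: flat_fun_def eventually_at_filter field_simps)
  with equal show ?thesis by (simp add: DERIV_def flat_fun_def)
next
  case greater
  have "((\<lambda>t. inverse t ^ n * exp (- inverse t)) has_field_derivative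
      (flat_fun (n + 2) t - real n * flat_fun (n + 1) t)) (at t)"
    using greater
    by (cases n) (auto intro!: derivative_eq_intros simp: flat_fun_def field_simps power2_eq_square,
        metis One_nat_def power_eq_if)
  then show ?thesis
    by (rule has_field_derivative_transform_within_open[where S = "{0<..}"]) (use greater in \<open>auto simp: flat_fun_def\<close>)
qed

lemma Ck_on_flat_fun: "Ck_on k UNIV (flat_fun n)"
proof (induction k arbitrary: n)
  case 0
  then show ?case
    using DERIV_isCont[OF flat_fun_has_derivative] by (auto intro: continuous_at_imp_continuous_on)
next
  case (Suc k)
  show ?case
  proof (rule Ck_on_SucI)
    show "(flat_fun n has_derivative (\<lambda>v. v *\<^sub>R flat_fun (n + 2) t + (- real n * v) *\<^sub>R flat_fun (n + 1) t)) (at t)" for t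
      using flat_fun_has_derivative[of n t]
      by (rule has_derivative_eq_rhs[OF has_field_derivative_imp_has_derivative])
        (simp add: fun_eq_iff algebra_simps)
    show "Ck_on k UNIV (\<lambda>t. v *\<^sub>R flat_fun (n + 2) t + (- real n * v) *\<^sub>R flat_fun (n + 1) t)" for v
      by (intro Ck_on_add Ck_on_scaleR Ck_on_const Suc.IH open_UNIV)
  qed simp
qed

section \<open>Charts, coordinates and smooth sections\<close>

lemma smooth_on_Ck: "smooth_on S f \<Longrightarrow> Ck_on k S f"
  by (simp add: smooth_on_def)

context
  fixes A :: "('a::{t2_space, second_countable_topology}, 'e::euclidean_space) atlas"
  assumes A: "smooth_atlas A"
begin

lemma open_chart_domain: "c \<in> A \<Longrightarrow> open (fst c)"
  using A by (auto simp: smooth_atlas_def)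

lemma homeomorphism_chart:
  "c \<in> A \<Longrightarrow> homeomorphism (fst c) (snd c ` fst c) (snd c) (chart_inv c)"
  using A by (auto simp: smooth_atlas_def)

lemma chart_inv_chart [simp]: "c \<in> A \<Longrightarrow> x \<in> fst c \<Longrightarrow> chart_inv c (snd c x) = x"
  using homeomorphism_chart by (auto simp: homeomorphism_def)

lemma open_chart_image:
  assumes "c \<in> A" "open V"
  shows "open (snd c ` (fst c \<inter> V))"
proof -
  note hom = homeomorphism_chart[OF assms(1)]
  have "snd c ` (fst c \<inter> V) = snd c ` fst c \<inter> chart_inv c -` V"
    using hom by (auto simp: homeomorphism_def)
  moreover have "open (snd c ` fst c \<inter> chart_inv c -` V)"
    using A assms hom by (intro continuous_open_preimage) (auto simp: homeomorphism_def smooth_atlas_def)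
  ultimately show ?thesis by simp
qed

lemma chart_at: "chart_at A x \<in> A" "x \<in> fst (chart_at A x)"
proof -
  have "x \<in> (\<Union>c\<in>A. fst c)" using A by (simp add: smooth_atlas_def)
  then have "\<exists>c. c \<in> A \<and> x \<in> fst c" by auto
  then have "chart_at A x \<in> A \<and> x \<in> fst (chart_at A x)"
    unfolding chart_at_def by (rule someI_ex)
  then show "chart_at A x \<in> A" "x \<in> fst (chart_at A x)" by auto
qed

lemma smooth_transition:
  "c \<in> A \<Longrightarrow> c' \<in> A \<Longrightarrow> smooth_on (snd c ` (fst c \<inter> fst c')) (snd c' \<circ> chart_inv c)"
  using A by (auto simp: smooth_atlas_def)

lemma transition_has_derivative:
  assumes "c \<in> A" "c' \<in> A" "x \<in> fst c" "x \<in> fst c'"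
  shows "((snd c' \<circ> chart_inv c) has_derivative
    frechet_derivative (snd c' \<circ> chart_inv c) (at (snd c x))) (at (snd c x))"
  using Ck_on_Suc_derivative[OF smooth_on_Ck[OF smooth_transition[OF assms(1,2)]]] assms(3,4) by auto

text \<open>
  The cocycle property of the derivatives of the chart transitions. Both \<open>coord\<close> and \<open>coord_field\<close> are
  such derivatives, from and to the preferred chart.
\<close>

lemma transition_derivative_trans:
  assumes "c1 \<in> A" "c2 \<in> A" "c3 \<in> A" "x \<in> fst c1" "x \<in> fst c2" "x \<in> fst c3"
  shows "frechet_derivative (snd c3 \<circ> chart_inv c2) (at (snd c2 x))
      (frechet_derivative (snd c2 \<circ> chart_inv c1) (at (snd c1 x)) v) =
    frechet_derivative (snd c3 \<circ> chart_inv c1) (at (snd c1 x)) v"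
proof -
  let ?T = "\<lambda>c c'. frechet_derivative (snd c' \<circ> chart_inv c) (at (snd c x))"
  have pt: "(snd c2 \<circ> chart_inv c1) (snd c1 x) = snd c2 x" using assms by simp
  have "((snd c2 \<circ> chart_inv c1) has_derivative ?T c1 c2) (at (snd c1 x))"
    by (intro transition_has_derivative assms)
  moreover have "((snd c3 \<circ> chart_inv c2) has_derivative ?T c2 c3)
      (at ((snd c2 \<circ> chart_inv c1) (snd c1 x)))"
    unfolding pt by (intro transition_has_derivative assms)
  ultimately have "((\<lambda>y. (snd c3 \<circ> chart_inv c2) ((snd c2 \<circ> chart_inv c1) y)) has_derivative
      (\<lambda>v. ?T c2 c3 (?T c1 c2 v))) (at (snd c1 x))"
    by (rule has_derivative_compose)
  then have "((snd c3 \<circ> chart_inv c1) has_derivative (\<lambda>v. ?T c2 c3 (?T c1 c2 v))) (at (snd c1 x))"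
    by (rule has_derivative_transform_within_open[OF _ open_chart_image[of c1 "fst c2"]])
      (use assms in \<open>auto simp: open_chart_domain\<close>)
  from frechet_derivative_at[OF this] show ?thesis by metis
qed

lemma transition_derivative_refl:
  assumes "c \<in> A" "x \<in> fst c"
  shows "frechet_derivative (snd c \<circ> chart_inv c) (at (snd c x)) v = v"
proof -
  have "((\<lambda>y. y) has_derivative (\<lambda>v. v)) (at (snd c x))" by simp
  then have "((snd c \<circ> chart_inv c) has_derivative (\<lambda>v. v)) (at (snd c x))"
    by (rule has_derivative_transform_within_open[OF _ open_chart_image[of c "UNIV"]]) (use assms in auto)
  from frechet_derivative_at[OF this] show ?thesis by metis
qed

lemma linear_coord: "c \<in> A \<Longrightarrow> x \<in> fst c \<Longrightarrow> linear (coord A c x)"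
  unfolding coord_def by (rule has_derivative_linear[OF transition_has_derivative]) (auto simp: chart_at)

lemma linear_coord_field: "c \<in> A \<Longrightarrow> x \<in> fst c \<Longrightarrow> linear (\<lambda>b. coord_field A c b x)"
  unfolding coord_field_def by (rule has_derivative_linear[OF transition_has_derivative]) (auto simp: chart_at)

lemma coord_coord_field:
  "c \<in> A \<Longrightarrow> c' \<in> A \<Longrightarrow> x \<in> fst c \<Longrightarrow> x \<in> fst c' \<Longrightarrow>
    coord A c' x (coord_field A c b x) = frechet_derivative (snd c' \<circ> chart_inv c) (at (snd c x)) b"
  unfolding coord_def coord_field_def by (rule transition_derivative_trans) (auto simp: chart_at)

lemma coord_field_coord: "c \<in> A \<Longrightarrow> x \<in> fst c \<Longrightarrow> coord_field A c (coord A c x v) x = v"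
  unfolding coord_def coord_field_def
  by (subst transition_derivative_trans) (auto simp: chart_at transition_derivative_refl)

lemma coord_chart_at: "coord A (chart_at A x) x v = v"
  unfolding coord_def by (rule transition_derivative_refl) (auto simp: chart_at)

lemma coord_field_chart_at: "coord_field A (chart_at A x) b x = b"
  unfolding coord_field_def by (rule transition_derivative_refl) (auto simp: chart_at)

lemma coord_field_expansion:
  assumes "c \<in> A" "x \<in> fst c"
  shows "v = (\<Sum>b\<in>Basis. (coord A c x v \<bullet> b) *\<^sub>R coord_field A c b x)"
proof -
  note lin = linear_coord_field[OF assms]
  have "v = coord_field A c (\<Sum>b\<in>Basis. (coord A c x v \<bullet> b) *\<^sub>R b) x"
    using assms by (simp add: euclidean_representation coord_field_coord)
  also have "\<dots> = (\<Sum>b\<in>Basis. (coord A c x v \<bullet> b) *\<^sub>R coord_field A c b x)"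
    by (simp add: linear_sum[OF lin] linear_cmul[OF lin])
  finally show ?thesis .
qed

text \<open>
  In the coordinates of another chart \<open>c'\<close>, the coordinate field of \<open>c\<close> is a partial derivative of the
  transition from \<open>c\<close> to \<open>c'\<close>; the preferred charts cancel.
\<close>

lemma coord_field_vector_field:
  assumes "c \<in> A"
  shows "coord_field A c b \<in> vector_fields A (fst c)"
  unfolding vector_fields_def sections_along_def mem_Collect_eq smooth_on_def
proof (intro ballI allI)
  fix c1 c2 k assume c: "c1 \<in> A" "c2 \<in> A"
  let ?U = "snd c1 ` (fst c1 \<inter> fst c \<inter> id -` fst c2)"
  have eq: "?U = snd c1 ` (fst c1 \<inter> (fst c \<inter> fst c2))" by auto
  have op: "open ?U" unfolding eq by (intro open_chart_image c open_Int open_chart_domain assms)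
  have op': "open (snd c ` (fst c \<inter> fst c2))" by (intro open_chart_image assms c open_chart_domain)
  have "Ck_on k ?U (\<lambda>y. frechet_derivative (snd c2 \<circ> chart_inv c) (at ((snd c \<circ> chart_inv c1) y)) b)"
  proof (rule Ck_on_compose[OF op op', where f = "\<lambda>z. frechet_derivative (snd c2 \<circ> chart_inv c) (at z) b"])
    show "(snd c \<circ> chart_inv c1) ` ?U \<subseteq> snd c ` (fst c \<inter> fst c2)" using c by auto
    show "Ck_on k ?U (snd c \<circ> chart_inv c1)"
      by (rule Ck_on_subset[OF smooth_on_Ck[OF smooth_transition[OF c(1) assms]]]) auto
    show "Ck_on k (snd c ` (fst c \<inter> fst c2)) (\<lambda>z. frechet_derivative (snd c2 \<circ> chart_inv c) (at z) b)"
      using smooth_on_Ck[OF smooth_transition[OF assms c(2)], of "Suc k"] by simp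
  qed
  then show "Ck_on k ?U (\<lambda>y. coord A c2 (id (chart_inv c1 y)) (coord_field A c b (chart_inv c1 y)))"
    by (rule Ck_on_cong[OF op, rotated]) (use c assms in \<open>auto simp: coord_coord_field\<close>)
qed

end

context
  fixes B :: "('b::{t2_space, second_countable_topology}, 'f::euclidean_space) atlas"
    and A :: "('a::{t2_space, second_countable_topology}, 'e::euclidean_space) atlas"
    and \<iota> :: "'b \<Rightarrow> 'a"
  assumes B: "smooth_atlas B" and A: "smooth_atlas A" and \<iota>: "continuous_on UNIV \<iota>"
begin

lemma open_section_domain:
  assumes "c \<in> B" "c' \<in> A" "open V"
  shows "open (snd c ` (fst c \<inter> V \<inter> \<iota> -` fst c'))"
proof -
  have "open (\<iota> -` fst c')"
    using open_vimage[OF open_chart_domain[OF A assms(2)]] \<iota> by auto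
  then show ?thesis using open_chart_image[OF B assms(1), of "V \<inter> \<iota> -` fst c'"] assms(3)
    by (simp add: Int_assoc open_Int)
qed

lemma sections_along_cong:
  assumes "open V" "X \<in> sections_along B A \<iota> V" "\<And>x. x \<in> V \<Longrightarrow> X x = Y x"
  shows "Y \<in> sections_along B A \<iota> V"
  unfolding sections_along_def mem_Collect_eq smooth_on_def
proof (intro ballI allI)
  fix c c' k assume c: "c \<in> B" "c' \<in> A"
  have "Ck_on k (snd c ` (fst c \<inter> V \<inter> \<iota> -` fst c'))
      (\<lambda>y. coord A c' (\<iota> (chart_inv c y)) (X (chart_inv c y)))"
    using assms(2) c by (auto simp: sections_along_def smooth_on_def)
  then show "Ck_on k (snd c ` (fst c \<inter> V \<inter> \<iota> -` fst c'))
      (\<lambda>y. coord A c' (\<iota> (chart_inv c y)) (Y (chart_inv c y)))"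
    by (rule Ck_on_cong[OF open_section_domain[OF c assms(1)], rotated])
      (use assms(3) c in \<open>auto simp: chart_inv_chart[OF B]\<close>)
qed

lemma sections_along_zero:
  assumes "open V"
  shows "(\<lambda>x. 0) \<in> sections_along B A \<iota> V"
  unfolding sections_along_def mem_Collect_eq smooth_on_def
proof (intro ballI allI)
  fix c c' k assume c: "c \<in> B" "c' \<in> A"
  show "Ck_on k (snd c ` (fst c \<inter> V \<inter> \<iota> -` fst c')) (\<lambda>y. coord A c' (\<iota> (chart_inv c y)) 0)"
    by (rule Ck_on_cong[OF open_section_domain[OF c assms], rotated,
          OF Ck_on_const[OF open_section_domain[OF c assms], of _ 0]])
      (use c in \<open>auto simp: chart_inv_chart[OF B] linear_0[OF linear_coord[OF A]]\<close>)
qed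

lemma sections_along_add:
  assumes "open V" "X \<in> sections_along B A \<iota> V" "Y \<in> sections_along B A \<iota> V"
  shows "(\<lambda>x. X x + Y x) \<in> sections_along B A \<iota> V"
  unfolding sections_along_def mem_Collect_eq smooth_on_def
proof (intro ballI allI)
  fix c c' k assume c: "c \<in> B" "c' \<in> A"
  let ?U = "snd c ` (fst c \<inter> V \<inter> \<iota> -` fst c')"
  have op: "open ?U" using c assms(1) by (rule open_section_domain)
  have "Ck_on k ?U (\<lambda>y. coord A c' (\<iota> (chart_inv c y)) (X (chart_inv c y)) +
      coord A c' (\<iota> (chart_inv c y)) (Y (chart_inv c y)))"
    using assms(2,3) c by (intro Ck_on_add op) (auto simp: sections_along_def smooth_on_def)
  then show "Ck_on k ?U (\<lambda>y. coord A c' (\<iota> (chart_inv c y)) (X (chart_inv c y) + Y (chart_inv c y)))"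
    by (rule Ck_on_cong[OF op, rotated])
      (use c in \<open>auto simp: chart_inv_chart[OF B] linear_add[OF linear_coord[OF A]]\<close>)
qed

lemma sections_along_scaleR:
  assumes "open V" "f \<in> smooth_functions B V" "X \<in> sections_along B A \<iota> V"
  shows "(\<lambda>x. f x *\<^sub>R X x) \<in> sections_along B A \<iota> V"
  unfolding sections_along_def mem_Collect_eq smooth_on_def
proof (intro ballI allI)
  fix c c' k assume c: "c \<in> B" "c' \<in> A"
  let ?U = "snd c ` (fst c \<inter> V \<inter> \<iota> -` fst c')"
  have op: "open ?U" using c assms(1) by (rule open_section_domain)
  have "Ck_on k (snd c ` (fst c \<inter> V)) (\<lambda>y. f (chart_inv c y))"
    using assms(2) c by (auto simp: smooth_functions_def smooth_on_def o_def)
  then have "Ck_on k ?U (\<lambda>y. f (chart_inv c y))" by (rule Ck_on_subset) auto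
  then have "Ck_on k ?U (\<lambda>y. f (chart_inv c y) *\<^sub>R coord A c' (\<iota> (chart_inv c y)) (X (chart_inv c y)))"
    using assms(3) c by (intro Ck_on_scaleR op) (simp_all add: sections_along_def smooth_on_def)
  then show "Ck_on k ?U (\<lambda>y. coord A c' (\<iota> (chart_inv c y)) (f (chart_inv c y) *\<^sub>R X (chart_inv c y)))"
    by (rule Ck_on_cong[OF op, rotated])
      (use c in \<open>auto simp: chart_inv_chart[OF B] linear_cmul[OF linear_coord[OF A]]\<close>)
qed

lemma sections_along_sum:
  assumes "open V" "\<And>i. i \<in> I \<Longrightarrow> X i \<in> sections_along B A \<iota> V"
  shows "(\<lambda>x. \<Sum>i\<in>I. X i x) \<in> sections_along B A \<iota> V"
  using assms(2)
  by (induction I rule: infinite_finite_induct)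
    (auto intro: sections_along_zero sections_along_add assms(1))

lemma sections_along_Union:
  assumes "\<And>V. V \<in> \<F> \<Longrightarrow> open V" "\<And>V. V \<in> \<F> \<Longrightarrow> X \<in> sections_along B A \<iota> V"
  shows "X \<in> sections_along B A \<iota> (\<Union>\<F>)"
  unfolding sections_along_def mem_Collect_eq smooth_on_def
proof (intro ballI allI)
  fix c c' k assume c: "c \<in> B" "c' \<in> A"
  have "Ck_on k (\<Union>((\<lambda>V. snd c ` (fst c \<inter> V \<inter> \<iota> -` fst c')) ` \<F>))
      (\<lambda>y. coord A c' (\<iota> (chart_inv c y)) (X (chart_inv c y)))"
    using assms c
    by (intro Ck_on_Union; elim imageE; clarsimp simp: sections_along_def smooth_on_def open_section_domain)
  moreover have "snd c ` (fst c \<inter> \<Union>\<F> \<inter> \<iota> -` fst c') = \<Union>((\<lambda>V. snd c ` (fst c \<inter> V \<inter> \<iota> -` fst c')) ` \<F>)"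
    by auto
  ultimately show "Ck_on k (snd c ` (fst c \<inter> \<Union>\<F> \<inter> \<iota> -` fst c'))
      (\<lambda>y. coord A c' (\<iota> (chart_inv c y)) (X (chart_inv c y)))" by simp
qed

end

text \<open>The Leibniz rule for the expansion of a vector field in a frame.\<close>

lemma affine_connection_sum:
  fixes A :: "('a::{t2_space, second_countable_topology}, 'e::euclidean_space) atlas"
  assumes A: "smooth_atlas A" and D: "affine_connection A D" and V: "open V" "x \<in> V"
    and Y: "\<And>i. i \<in> I \<Longrightarrow> Y i \<in> vector_fields A V"
    and f: "\<And>i. i \<in> I \<Longrightarrow> f i \<in> smooth_functions A V" and "finite I"
  shows "D x v (\<lambda>y. \<Sum>i\<in>I. f i y *\<^sub>R Y i y) =
    (\<Sum>i\<in>I. dir_deriv A (f i) x v *\<^sub>R Y i x + f i x *\<^sub>R D x v (Y i))"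
proof -
  have add: "D x v (\<lambda>y. X y + Z y) = D x v X + D x v Z"
    if "X \<in> vector_fields A V" "Z \<in> vector_fields A V" for X Z
    using D[unfolded affine_connection_def, rule_format, OF V(1) that(1)] V(2) that(2) by blast
  have leib: "D x v (\<lambda>y. h y *\<^sub>R X y) = dir_deriv A h x v *\<^sub>R X x + h x *\<^sub>R D x v X"
    if "X \<in> vector_fields A V" "h \<in> smooth_functions A V" for X h
    using D[unfolded affine_connection_def, rule_format, OF V(1) that(1)] V(2) that(2) by blast
  have zero: "(\<lambda>y. 0) \<in> vector_fields A V" unfolding vector_fields_def
    by (rule sections_along_zero[OF A A _ V(1)]) (simp add: id_def)
  have scaleR: "(\<lambda>y. h y *\<^sub>R X y) \<in> vector_fields A V"
    if "X \<in> vector_fields A V" "h \<in> smooth_functions A V" for X h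
    using that unfolding vector_fields_def
    by (intro sections_along_scaleR[OF A A _ V(1)]) (auto simp: id_def)
  have sum: "(\<lambda>y. \<Sum>i\<in>K. f i y *\<^sub>R Y i y) \<in> vector_fields A V" if "K \<subseteq> I" for K
    using that scaleR Y f unfolding vector_fields_def
    by (intro sections_along_sum[OF A A _ V(1)]) (auto simp: id_def)
  show ?thesis using \<open>finite I\<close> Y f sum
  proof (induction I rule: finite_induct)
    case empty
    show ?case using add[OF zero zero] by simp
  next
    case (insert i I)
    have "D x v (\<lambda>y. f i y *\<^sub>R Y i y + (\<Sum>i\<in>I. f i y *\<^sub>R Y i y)) =
        D x v (\<lambda>y. f i y *\<^sub>R Y i y) + D x v (\<lambda>y. \<Sum>i\<in>I. f i y *\<^sub>R Y i y)"
      by (rule add) (use insert.prems in \<open>auto intro: scaleR\<close>)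
    moreover have "D x v (\<lambda>y. \<Sum>i\<in>I. f i y *\<^sub>R Y i y) =
        (\<Sum>i\<in>I. dir_deriv A (f i) x v *\<^sub>R Y i x + f i x *\<^sub>R D x v (Y i))"
      by (rule insert.IH) (use insert.prems(1,2) insert.prems(3)[OF subset_insertI2] in auto)
    ultimately show ?case using insert.hyps insert.prems(1,2) by (simp add: leib)
  qed
qed

section \<open>A parallel endomorphism commutes with the connection along a map\<close>

lemma smooth_map_has_derivative:
  fixes B :: "('b::{t2_space, second_countable_topology}, 'f::euclidean_space) atlas"
    and A :: "('a::{t2_space, second_countable_topology}, 'e::euclidean_space) atlas"
  assumes B: "smooth_atlas B" and A: "smooth_atlas A" and \<iota>: "smooth_map B A \<iota>"
  shows "((snd (chart_at A (\<iota> x)) \<circ> \<iota> \<circ> chart_inv (chart_at B x)) has_derivative differential B A \<iota> x)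
    (at (snd (chart_at B x) x))"
proof -
  have "smooth_on (snd (chart_at B x) ` (fst (chart_at B x) \<inter> \<iota> -` fst (chart_at A (\<iota> x))))
      (snd (chart_at A (\<iota> x)) \<circ> \<iota> \<circ> chart_inv (chart_at B x))"
    using \<iota> chart_at[OF A, of "\<iota> x"] chart_at[OF B, of x] by (auto simp: smooth_map_def)
  from Ck_on_Suc_derivative[OF smooth_on_Ck[OF this]] show ?thesis
    unfolding differential_def using chart_at[OF A, of "\<iota> x"] chart_at[OF B, of x] by auto
qed

text \<open>
  Let \<open>E\<^sub>b\<close> be the coordinate fields of the preferred chart at \<open>\<iota> x\<close>, and let \<open>M\<^sub>b\<close> be the coordinate
  expression of \<open>J E\<^sub>b\<close>. Along \<open>\<iota>\<close>, the coordinates of \<open>J U\<close> are \<open>\<Sum>b. U\<^sup>b M\<^sub>b\<close>, whose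
  derivative involves the derivatives of \<open>M\<^sub>b\<close>. The same derivatives appear when the Leibniz rule is
  applied to \<open>J (D E\<^sub>b) = D (J E\<^sub>b) = D (\<Sum>b'. (M\<^sub>b \<bullet> b') E\<^sub>b\<^sub>')\<close>, and the two expressions match. Only the
  value \<open>W x\<close> has to be tangent to the submanifold.
\<close>

lemma conn_along_endomorphism:
  fixes B :: "('b::{t2_space, second_countable_topology}, 'f::euclidean_space) atlas"
    and A :: "('a::{t2_space, second_countable_topology}, 'e::euclidean_space) atlas"
  assumes B: "smooth_atlas B" and A: "smooth_atlas A" and \<iota>: "smooth_map B A \<iota>"
    and D: "affine_connection A D" and J: "smooth_endomorphism_field A J"
    and par: "parallel_endomorphism A D J"
    and U: "U \<in> sections_along B A \<iota> UNIV" and W: "W x \<in> tangent_bundle B A \<iota> x"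
  shows "conn_along B A \<iota> D W (\<lambda>y. J (\<iota> y) (U y)) x = J (\<iota> x) (conn_along B A \<iota> D W U x)"
proof -
  define c where "c = chart_at A (\<iota> x)"
  define d where "d = chart_at B x"
  define w where "w = inv (differential B A \<iota> x) (W x)"
  define u where "u y = coord A c (\<iota> (chart_inv d y)) (U (chart_inv d y))" for y
  define M where "M b z = coord A c z (J z (coord_field A c b z))" for b z
  define M' where "M' b = frechet_derivative (M b \<circ> chart_inv c) (at (snd c (\<iota> x)))" for b
  define u' where "u' = frechet_derivative u (at (snd d x))"
  let ?E = "\<lambda>b. coord_field A c b" and ?N = "snd d ` (fst d \<inter> \<iota> -` fst c)"
  have c: "c \<in> A" "\<iota> x \<in> fst c" and d: "d \<in> B" "x \<in> fst d"
    using chart_at[OF A] chart_at[OF B] by (auto simp: c_def d_def)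
  have lJ: "linear (J z)" for z using J by (simp add: smooth_endomorphism_field_def)
  have diff_w: "differential B A \<iota> x w = W x"
    using W unfolding w_def tangent_bundle_def by (rule f_inv_into_f)
  have cont: "continuous_on UNIV \<iota>" using \<iota> by (simp add: smooth_map_def)
  have N: "open ?N" using open_section_domain[OF B A cont d(1) c(1) open_UNIV] by simp
  have x_N: "snd d x \<in> ?N" using c d by auto
  have E: "?E b \<in> vector_fields A (fst c)" for b
    by (rule coord_field_vector_field[OF A c(1)])
  have JE: "(\<lambda>z. J z (?E b z)) \<in> vector_fields A (fst c)" for b
    using J E open_chart_domain[OF A c(1)] by (auto simp: smooth_endomorphism_field_def)
  have u: "(u has_derivative u') (at (snd d x))"
  proof -
    have "Ck_on (Suc 0) ?N u"
      using U c d by (auto simp: sections_along_def smooth_on_def u_def[abs_def] simp del: Ck_on.simps)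
    from Ck_on_Suc_derivative[OF this x_N] show ?thesis by (simp only: u'_def)
  qed
  have M_Ck: "Ck_on k (snd c1 ` (fst c1 \<inter> fst c)) (\<lambda>y. M b (chart_inv c1 y))" if "c1 \<in> A" for b c1 k
  proof -
    have "smooth_on (snd c1 ` (fst c1 \<inter> fst c \<inter> id -` fst c))
        (\<lambda>y. coord A c (id (chart_inv c1 y)) (J (chart_inv c1 y) (?E b (chart_inv c1 y))))"
      using JE[of b] c(1) that unfolding vector_fields_def sections_along_def mem_Collect_eq by blast
    moreover have "fst c1 \<inter> fst c \<inter> id -` fst c = fst c1 \<inter> fst c" by auto
    ultimately show ?thesis by (intro smooth_on_Ck) (simp only: M_def id_apply)
  qed
  have M: "((M b \<circ> chart_inv c) has_derivative M' b) (at (snd c (\<iota> x)))" for b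
    using Ck_on_Suc_derivative[OF M_Ck[OF c(1), of "Suc 0" b], of "snd c (\<iota> x)"] c(2)
    by (simp add: M'_def o_def)
  have M_at: "M b (\<iota> x) = J (\<iota> x) b" for b
    by (simp add: M_def c_def coord_chart_at[OF A] coord_field_chart_at[OF A])
  have u_at: "u (snd d x) = U x"
    using d by (simp add: u_def chart_inv_chart[OF B] c_def coord_chart_at[OF A])
  \<comment> \<open>The derivative of the components of \<open>J U\<close>, by the product rule and the chain rule.\<close>
  have deriv: "frechet_derivative (\<lambda>y. coord A c (\<iota> (chart_inv d y))
        (J (\<iota> (chart_inv d y)) (U (chart_inv d y)))) (at (snd d x)) w =
      (\<Sum>b\<in>Basis. (U x \<bullet> b) *\<^sub>R M' b (W x) + (u' w \<bullet> b) *\<^sub>R J (\<iota> x) b)"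
  proof -
    have \<phi>: "((snd c \<circ> \<iota> \<circ> chart_inv d) has_derivative differential B A \<iota> x) (at (snd d x))"
      unfolding c_def d_def by (rule smooth_map_has_derivative[OF B A \<iota>])
    have \<phi>_at: "(snd c \<circ> \<iota> \<circ> chart_inv d) (snd d x) = snd c (\<iota> x)"
      using d by (simp add: chart_inv_chart[OF B])
    have M_\<phi>: "((\<lambda>y. (M b \<circ> chart_inv c) ((snd c \<circ> \<iota> \<circ> chart_inv d) y)) has_derivative
        (\<lambda>v. M' b (differential B A \<iota> x v))) (at (snd d x))" for b
      by (rule has_derivative_compose[OF \<phi> M[of b, folded \<phi>_at]])
    have "((\<lambda>y. \<Sum>b\<in>Basis. (u y \<bullet> b) *\<^sub>R (M b \<circ> chart_inv c) ((snd c \<circ> \<iota> \<circ> chart_inv d) y)) has_derivative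
        (\<lambda>v. \<Sum>b\<in>Basis. (u (snd d x) \<bullet> b) *\<^sub>R M' b (differential B A \<iota> x v) +
          (u' v \<bullet> b) *\<^sub>R (M b \<circ> chart_inv c) ((snd c \<circ> \<iota> \<circ> chart_inv d) (snd d x)))) (at (snd d x))"
      by (intro has_derivative_sum has_derivative_scaleR
          bounded_linear.has_derivative[OF bounded_linear_inner_left u] M_\<phi>)
    then have "((\<lambda>y. coord A c (\<iota> (chart_inv d y)) (J (\<iota> (chart_inv d y)) (U (chart_inv d y)))) has_derivative
        (\<lambda>v. \<Sum>b\<in>Basis. (u (snd d x) \<bullet> b) *\<^sub>R M' b (differential B A \<iota> x v) +
          (u' v \<bullet> b) *\<^sub>R (M b \<circ> chart_inv c) ((snd c \<circ> \<iota> \<circ> chart_inv d) (snd d x)))) (at (snd d x))"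
    proof (rule has_derivative_transform_within_open[OF _ N x_N])
      fix y assume "y \<in> ?N"
      define z where "z = \<iota> (chart_inv d y)"
      have z: "z \<in> fst c" using \<open>y \<in> ?N\<close> d by (auto simp: z_def chart_inv_chart[OF B])
      have lin: "linear (\<lambda>v. coord A c z (J z v))"
        using linear_compose[OF lJ linear_coord[OF A c(1) z]] by (simp add: o_def)
      have "coord A c z (J z (U (chart_inv d y))) =
          coord A c z (J z (\<Sum>b\<in>Basis. (u y \<bullet> b) *\<^sub>R ?E b z))"
        using coord_field_expansion[OF A c(1) z, of "U (chart_inv d y)"] by (simp add: u_def z_def)
      also have "\<dots> = (\<Sum>b\<in>Basis. (u y \<bullet> b) *\<^sub>R M b z)"
        by (simp add: M_def linear_sum[OF lin] linear_cmul[OF lin])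
      finally show "(\<Sum>b\<in>Basis. (u y \<bullet> b) *\<^sub>R (M b \<circ> chart_inv c) ((snd c \<circ> \<iota> \<circ> chart_inv d) y)) =
          coord A c (\<iota> (chart_inv d y)) (J (\<iota> (chart_inv d y)) (U (chart_inv d y)))"
        using z c(1) by (simp add: z_def chart_inv_chart[OF A])
    qed
    from frechet_derivative_at[OF this, symmetric] show ?thesis
      using c d by (simp add: diff_w u_at M_at chart_inv_chart[OF A] chart_inv_chart[OF B])
  qed
  \<comment> \<open>\<open>J E\<^sub>b\<close> in terms of the coordinate fields, differentiated by the Leibniz rule.\<close>
  have nabla: "J (\<iota> x) (D (\<iota> x) (W x) (?E b)) =
      M' b (W x) + (\<Sum>b'\<in>Basis. (J (\<iota> x) b \<bullet> b') *\<^sub>R D (\<iota> x) (W x) (?E b'))" for b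
  proof -
    have f: "(\<lambda>z. M b z \<bullet> b') \<in> smooth_functions A (fst c)" for b'
      unfolding smooth_functions_def smooth_on_def mem_Collect_eq
    proof (intro ballI allI)
      fix c1 k assume c1: "c1 \<in> A"
      show "Ck_on k (snd c1 ` (fst c1 \<inter> fst c)) ((\<lambda>z. M b z \<bullet> b') \<circ> chart_inv c1)"
        unfolding o_def
        by (intro Ck_on_linear[OF open_chart_image[OF A c1 open_chart_domain[OF A c(1)]]
              bounded_linear_inner_left M_Ck[OF c1]])
    qed
    have df: "dir_deriv A (\<lambda>z. M b z \<bullet> b') (\<iota> x) v = M' b v \<bullet> b'" for b' v
    proof -
      have "((\<lambda>y. (M b \<circ> chart_inv c) y \<bullet> b') has_derivative (\<lambda>v. M' b v \<bullet> b')) (at (snd c (\<iota> x)))"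
        by (rule bounded_linear.has_derivative[OF bounded_linear_inner_left M])
      from frechet_derivative_at[OF this] show ?thesis
        unfolding dir_deriv_def c_def[symmetric] by (simp add: o_def fun_eq_iff)
    qed
    have eq: "(\<Sum>b'\<in>Basis. (M b z \<bullet> b') *\<^sub>R ?E b' z) = J z (?E b z)" if "z \<in> fst c" for z
      using coord_field_expansion[OF A c(1) that, of "J z (?E b z)"] by (simp add: M_def)
    have "J (\<iota> x) (D (\<iota> x) (W x) (?E b)) = D (\<iota> x) (W x) (\<lambda>z. J z (?E b z))"
      using par E[of b] c(2) open_chart_domain[OF A c(1)] unfolding parallel_endomorphism_def by fastforce
    also have "\<dots> = D (\<iota> x) (W x) (\<lambda>z. \<Sum>b'\<in>Basis. (M b z \<bullet> b') *\<^sub>R ?E b' z)"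
      using D[unfolded affine_connection_def, rule_format, OF open_chart_domain[OF A c(1)] JE[of b]] c(2) eq
      by (metis (no_types, lifting))
    also have "\<dots> = (\<Sum>b'\<in>Basis. (M' b (W x) \<bullet> b') *\<^sub>R b' + (J (\<iota> x) b \<bullet> b') *\<^sub>R D (\<iota> x) (W x) (?E b'))"
      using affine_connection_sum[OF A D open_chart_domain[OF A c(1)] c(2) E f finite_Basis]
      by (simp add: df M_at) (simp add: c_def coord_field_chart_at[OF A])
    finally show ?thesis by (simp add: sum.distrib euclidean_representation)
  qed
  let ?D = "\<lambda>b. D (\<iota> x) (W x) (?E b)"
  have J_expand: "J (\<iota> x) v = (\<Sum>b\<in>Basis. (v \<bullet> b) *\<^sub>R J (\<iota> x) b)" for v
    by (subst euclidean_representation[of v, symmetric]) (simp only: linear_sum[OF lJ] linear_cmul[OF lJ])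
  have "conn_along B A \<iota> D W (\<lambda>y. J (\<iota> y) (U y)) x =
      (\<Sum>b\<in>Basis. (U x \<bullet> b) *\<^sub>R M' b (W x)) + J (\<iota> x) (u' w) +
      (\<Sum>b'\<in>Basis. (J (\<iota> x) (U x) \<bullet> b') *\<^sub>R ?D b')"
    using deriv unfolding conn_along_def Let_def c_def[symmetric] d_def[symmetric] w_def[symmetric]
    by (simp add: sum.distrib J_expand[of "u' w"])
  also have "(\<Sum>b'\<in>Basis. (J (\<iota> x) (U x) \<bullet> b') *\<^sub>R ?D b') =
      (\<Sum>b\<in>Basis. (U x \<bullet> b) *\<^sub>R (\<Sum>b'\<in>Basis. (J (\<iota> x) b \<bullet> b') *\<^sub>R ?D b'))"
    by (subst J_expand) (simp add: inner_sum_left scaleR_sum_left scaleR_sum_right, rule sum.swap)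
  finally have "conn_along B A \<iota> D W (\<lambda>y. J (\<iota> y) (U y)) x =
      J (\<iota> x) (u' w) + (\<Sum>b\<in>Basis. (U x \<bullet> b) *\<^sub>R J (\<iota> x) (?D b))"
    by (simp add: nabla scaleR_add_right sum.distrib)
  moreover have "conn_along B A \<iota> D W U x = u' w + (\<Sum>b\<in>Basis. (U x \<bullet> b) *\<^sub>R ?D b)"
    unfolding conn_along_def Let_def c_def[symmetric] d_def[symmetric] w_def[symmetric] u'_def u_def[abs_def] ..
  ultimately show ?thesis
    by (simp add: linear_add[OF lJ] linear_sum[OF lJ] linear_cmul[OF lJ])
qed

section \<open>Sections of a subbundle through a given vector\<close>

text \<open>
  The bump is a flat function of \<open>R\<^sup>2 - |y - d(x)|\<^sup>2\<close> in a chart \<open>d\<close>. The set \<open>K\<close>, the preimage of a closed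
  ball, is compact and therefore closed in the manifold, which is what makes the extension by \<open>0\<close> smooth.
  The value at \<open>x\<close> is not normalised.
\<close>

lemma smooth_bump_exists:
  fixes B :: "('b::{t2_space, second_countable_topology}, 'f::euclidean_space) atlas"
  assumes B: "smooth_atlas B" and V: "open V" "x \<in> V"
  obtains \<phi> K where "\<phi> \<in> smooth_functions B UNIV" "\<phi> x \<noteq> 0" "closed K" "K \<subseteq> V"
    "\<forall>y. y \<notin> K \<longrightarrow> \<phi> y = 0"
proof -
  define d where "d = chart_at B x"
  have d: "d \<in> B" "x \<in> fst d" using chart_at[OF B] by (auto simp: d_def)
  obtain R where R: "R > 0" "cball (snd d x) R \<subseteq> snd d ` (fst d \<inter> V)"
    using open_chart_image[OF B d(1) V(1)] d(2) V(2)
    unfolding open_contains_cball by (metis IntI imageI)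
  define K where "K = chart_inv d ` cball (snd d x) R"
  define \<beta> where "\<beta> y = flat_fun 0 (R\<^sup>2 + - 1 *\<^sub>R ((y + - snd d x) \<bullet> (y + - snd d x)))" for y
  define \<phi> where "\<phi> y = (if y \<in> fst d then \<beta> (snd d y) else 0)" for y
  have "K \<subseteq> chart_inv d ` snd d ` (fst d \<inter> V)"
    unfolding K_def using R(2) by (rule image_mono)
  also have "\<dots> = fst d \<inter> V"
    using d(1) by (force simp: image_image chart_inv_chart[OF B])
  finally have K_sub: "K \<subseteq> fst d \<inter> V" .
  have "continuous_on (snd d ` fst d) (chart_inv d)"
    using homeomorphism_chart[OF B d(1)] by (simp add: homeomorphism_def)
  then have "continuous_on (cball (snd d x) R) (chart_inv d)"
    by (rule continuous_on_subset) (use R(2) in auto)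
  then have "compact K"
    unfolding K_def by (intro compact_continuous_image) auto
  then have "closed K" by (rule compact_imp_closed)
  have zero: "\<phi> y = 0" if "y \<notin> K" for y
  proof (cases "y \<in> fst d")
    case True
    then have "snd d y \<notin> cball (snd d x) R"
      using that d(1) by (force simp: K_def chart_inv_chart[OF B])
    then have "R < norm (snd d y - snd d x)" by (simp add: dist_norm norm_minus_commute)
    then have "R\<^sup>2 < (norm (snd d y - snd d x))\<^sup>2"
      using R(1) by (intro power_strict_mono) auto
    with True show ?thesis by (simp add: \<phi>_def \<beta>_def flat_fun_def power2_norm_eq_inner)
  qed (simp add: \<phi>_def)
  have \<beta>: "Ck_on k UNIV \<beta>" for k
  proof -
    have id: "Ck_on k UNIV (\<lambda>y. y)" for k
      by (cases k) (auto intro: Ck_on_const)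
    have "Ck_on k UNIV (\<lambda>y. R\<^sup>2 + - 1 *\<^sub>R ((y + - snd d x) \<bullet> (y + - snd d x)))"
      by (intro Ck_on_add Ck_on_scaleR Ck_on_bilinear[OF _ bounded_bilinear_inner] Ck_on_const id open_UNIV)
    then show ?thesis unfolding \<beta>_def
      by (rule Ck_on_compose[OF open_UNIV open_UNIV _ _ Ck_on_flat_fun, rotated]) simp
  qed
  have "\<phi> \<in> smooth_functions B UNIV"
    unfolding smooth_functions_def smooth_on_def mem_Collect_eq
  proof (intro ballI allI)
    fix c k assume c: "c \<in> B"
    let ?U1 = "snd c ` (fst c \<inter> fst d)" and ?U2 = "snd c ` (fst c \<inter> - K)"
    have op1: "open ?U1" by (intro open_chart_image[OF B c] open_chart_domain[OF B d(1)])
    have op2: "open ?U2" using \<open>closed K\<close> by (intro open_chart_image[OF B c]) auto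
    have "Ck_on k ?U1 (\<lambda>y. \<beta> ((snd d \<circ> chart_inv c) y))"
      by (rule Ck_on_compose[OF op1 open_UNIV subset_UNIV smooth_on_Ck[OF smooth_transition[OF B c d(1)]] \<beta>])
    then have 1: "Ck_on k ?U1 (\<phi> \<circ> chart_inv c)"
      by (rule Ck_on_cong[OF op1, rotated]) (use c in \<open>auto simp: \<phi>_def chart_inv_chart[OF B]\<close>)
    have 2: "Ck_on k ?U2 (\<phi> \<circ> chart_inv c)"
      by (rule Ck_on_cong[OF op2 _ Ck_on_const[OF op2, of _ 0]])
        (use c zero in \<open>auto simp: chart_inv_chart[OF B]\<close>)
    have "snd c ` (fst c \<inter> UNIV) = \<Union>{?U1, ?U2}" using K_sub by auto
    moreover have "Ck_on k (\<Union>{?U1, ?U2}) (\<phi> \<circ> chart_inv c)"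
      by (rule Ck_on_Union) (use 1 2 op1 op2 in auto)
    ultimately show "Ck_on k (snd c ` (fst c \<inter> UNIV)) (\<phi> \<circ> chart_inv c)" by (simp only:)
  qed
  moreover have "\<phi> x \<noteq> 0" using d R(1) by (simp add: \<phi>_def \<beta>_def flat_fun_def)
  ultimately show ?thesis
    by (rule that) (use \<open>closed K\<close> K_sub zero in auto)
qed

lemma local_frame_expansion:
  assumes "local_frame B A \<iota> k E V \<xi>" "x \<in> V" "v \<in> E x"
  obtains a where "v = (\<Sum>i<k. a i *\<^sub>R \<xi> i x)"
proof -
  have inj: "inj_on (\<lambda>i. \<xi> i x) {..<k}" and "v \<in> span ((\<lambda>i. \<xi> i x) ` {..<k})"
    using assms by (auto simp: local_frame_def)
  then obtain u where "v = (\<Sum>w\<in>(\<lambda>i. \<xi> i x) ` {..<k}. u w *\<^sub>R w)"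
    by (auto simp: span_finite)
  then show ?thesis using that[of "\<lambda>i. u (\<xi> i x)"] by (simp add: sum.reindex[OF inj])
qed

lemma local_frame_mem:
  assumes "local_frame B A \<iota> k E V \<xi>" "x \<in> V" "i < k"
  shows "\<xi> i x \<in> E x"
proof -
  have "span ((\<lambda>i. \<xi> i x) ` {..<k}) = E x" using assms(1,2) by (simp add: local_frame_def)
  moreover have "\<xi> i x \<in> span ((\<lambda>i. \<xi> i x) ` {..<k})" using assms(3) by (intro span_base) simp
  ultimately show ?thesis by simp
qed

lemma subspace_subbundle:
  assumes "smooth_subbundle B A \<iota> k E"
  shows "subspace (E x)"
proof -
  obtain V \<xi> where "x \<in> V" "local_frame B A \<iota> k E V \<xi>"
    using assms unfolding smooth_subbundle_def by blast
  then have "span ((\<lambda>i. \<xi> i x) ` {..<k}) = E x" by (simp add: local_frame_def)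
  then show ?thesis using subspace_span by metis
qed

text \<open>
  A combination with constant coefficients of a local frame, multiplied by a bump function.
\<close>

lemma section_through_vector:
  fixes B :: "('b::{t2_space, second_countable_topology}, 'f::euclidean_space) atlas"
    and A :: "('a::{t2_space, second_countable_topology}, 'e::euclidean_space) atlas"
  assumes B: "smooth_atlas B" and A: "smooth_atlas A" and \<iota>: "continuous_on UNIV \<iota>"
    and E: "smooth_subbundle B A \<iota> k E" and v: "v \<in> E x"
  obtains X where "X \<in> sections B A \<iota> E" "X x = v"
proof -
  obtain V \<xi> where V: "open V" "x \<in> V" and \<xi>: "local_frame B A \<iota> k E V \<xi>"
    using E unfolding smooth_subbundle_def by blast
  obtain \<phi> K where \<phi>: "\<phi> \<in> smooth_functions B UNIV" "\<phi> x \<noteq> 0" and K: "closed K" "K \<subseteq> V"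
    and zero: "\<forall>y. y \<notin> K \<longrightarrow> \<phi> y = 0"
    by (rule smooth_bump_exists[OF B V])
  \<comment> \<open>The scaling compensates for the value of the bump at \<open>x\<close>.\<close>
  have "inverse (\<phi> x) *\<^sub>R v \<in> E x" using subspace_subbundle[OF E] v by (rule subspace_scale)
  then obtain a where a: "inverse (\<phi> x) *\<^sub>R v = (\<Sum>i<k. a i *\<^sub>R \<xi> i x)"
    by (rule local_frame_expansion[OF \<xi> V(2)])
  define X where "X y = (if y \<in> V then \<phi> y *\<^sub>R (\<Sum>i<k. a i *\<^sub>R \<xi> i y) else 0)" for y
  have const: "(\<lambda>y. t) \<in> smooth_functions B V" for t
    using open_chart_image[OF B _ V(1)] by (auto simp: smooth_functions_def smooth_on_def o_def intro: Ck_on_const)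
  have "\<phi> \<in> smooth_functions B V"
    using \<phi>(1) unfolding smooth_functions_def smooth_on_def mem_Collect_eq
    by (blast intro: Ck_on_subset[OF _ image_mono[OF Int_mono[OF subset_refl subset_UNIV]]])
  moreover have "(\<lambda>y. \<Sum>i<k. a i *\<^sub>R \<xi> i y) \<in> sections_along B A \<iota> V"
    using \<xi> by (intro sections_along_sum[OF B A \<iota> V(1)] sections_along_scaleR[OF B A \<iota> V(1) const])
      (auto simp: local_frame_def)
  ultimately have "(\<lambda>y. \<phi> y *\<^sub>R (\<Sum>i<k. a i *\<^sub>R \<xi> i y)) \<in> sections_along B A \<iota> V"
    by (rule sections_along_scaleR[OF B A \<iota> V(1)])
  then have 1: "X \<in> sections_along B A \<iota> V"
    by (rule sections_along_cong[OF B A \<iota> V(1)]) (simp add: X_def)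
  have 2: "X \<in> sections_along B A \<iota> (- K)"
    by (rule sections_along_cong[OF B A \<iota> _ sections_along_zero[OF B A \<iota>]])
      (use K(1) zero in \<open>auto simp: X_def\<close>)
  have "X \<in> sections_along B A \<iota> (\<Union>{V, - K})"
    by (rule sections_along_Union[OF B A \<iota>]) (use 1 2 V(1) K(1) in auto)
  moreover have "\<Union>{V, - K} = UNIV" using K(2) by auto
  moreover have "X y \<in> E y" for y
  proof (cases "y \<in> V")
    case True
    then have "\<phi> y *\<^sub>R (\<Sum>i<k. a i *\<^sub>R \<xi> i y) \<in> E y"
      using local_frame_mem[OF \<xi>] by (intro subspace_scale subspace_sum subspace_subbundle[OF E]) simp
    with True show ?thesis by (simp add: X_def)
  qed (simp add: X_def subspace_0[OF subspace_subbundle[OF E]])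
  ultimately have "X \<in> sections B A \<iota> E" by (simp add: sections_def)
  moreover have "X x = v" using V(2) \<phi>(2) by (simp add: X_def a[symmetric])
  ultimately show ?thesis by (rule that)
qed

section \<open>Linear algebra of the lightlike decomposition\<close>

text \<open>
  A basis \<open>E\<close> of \<open>S\<close> turns the form into the map \<open>v \<mapsto> \<Sum>e\<in>E. b(v, e) e\<close> into \<open>S\<close>, which is injective
  on \<open>S\<close> by non-degeneracy and hence maps \<open>S\<close> onto \<open>S\<close>.
\<close>

lemma nondegenerate_projection:
  fixes b :: "'e::euclidean_space \<Rightarrow> 'e \<Rightarrow> real"
  assumes b: "bilinear b" and S: "subspace S" and nondeg: "nondegenerate_on b S"
  shows "\<exists>s\<in>S. \<forall>w\<in>S. b (v - s) w = 0"
proof -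
  obtain E where E: "E \<subseteq> S" "independent E" "span E = S"
    using basis_exists[of S] S by (metis span_subspace)
  have fin: "finite E" using E(2) by (rule independent_imp_finite)
  define T where "T v = (\<Sum>e\<in>E. b v e *\<^sub>R e)" for v
  have lin: "linear T"
    by (rule linearI) (simp_all add: T_def bilinear_ladd[OF b] bilinear_lmul[OF b]
        scaleR_add_left sum.distrib scaleR_sum_right)
  have T_S: "T v \<in> S" for v
    unfolding T_def using S E(1) by (intro subspace_sum subspace_scale) auto
  have ker: "b v w = 0" if "T v = 0" "w \<in> S" for v w
  proof -
    have "b v e = 0" if "e \<in> E" for e
      using E(2) fin \<open>T v = 0\<close> that unfolding T_def independent_explicit by blast
    moreover have "linear (b v)" using b by (simp add: bilinear_def)
    ultimately show ?thesis using \<open>w \<in> S\<close> E(3) linear_eq_0_on_span[of "b v" E w] by blast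
  qed
  have "inj_on T S"
  proof (rule inj_onI)
    fix x y assume xy: "x \<in> S" "y \<in> S" "T x = T y"
    have "x - y \<in> S" using S xy(1,2) by (rule subspace_diff)
    moreover have "T (x - y) = 0" using xy(3) by (simp add: linear_diff[OF lin])
    ultimately show "x = y" using ker nondeg by (auto simp: nondegenerate_on_def)
  qed
  then have "dim (T ` S) = dim S"
    using S lin by (intro dim_image_eq) (auto simp: span_eq_iff[THEN iffD2])
  then have "T ` S = S"
    using S lin T_S by (intro subspace_dim_equal) (auto intro: linear_subspace_image)
  then obtain s where s: "s \<in> S" "T s = T v" using T_S by (metis imageE)
  then have "T (v - s) = 0" by (simp add: linear_diff[OF lin])
  with s(1) ker show ?thesis by blast
qed

lemma direct_sum_right:
  assumes "direct_sum E F G" "v \<in> F"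
  shows "v \<in> G"
proof -
  have sum: "{u + v |u v. u \<in> E \<and> v \<in> F} = G" and "0 \<in> E"
    using assms(1) by (auto simp: direct_sum_def)
  then have "0 + v \<in> {u + v |u v. u \<in> E \<and> v \<in> F}" using assms(2) by blast
  then show ?thesis unfolding sum by simp
qed

text \<open>
  The situation in a single fibre: \<open>T\<close> is the tangent space, \<open>R\<close> the radical, \<open>S\<close> the screen, \<open>P\<close> the screen
  transversal space and \<open>L\<close> the lightlike transversal space; \<open>\<xi>\<close> and \<open>N\<close> are dual frames of \<open>R\<close> and \<open>L\<close>.
  The orthogonal complement of \<open>T\<close> is spelled out. Only the spanning property of the frames
  is assumed, as their independence follows from the duality.
\<close>

locale lightlike_splitting =
  fixes b :: "'e::euclidean_space \<Rightarrow> 'e \<Rightarrow> real"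
    and T R S P L :: "'e set" and r :: nat and \<xi> N :: "nat \<Rightarrow> 'e"
  assumes b: "bilinear b" and sym: "b v w = b w v"
    and subspaces: "subspace T" "subspace S" "subspace P" "subspace L"
    and R: "R = T \<inter> {v. \<forall>w\<in>T. b v w = 0}"
    and T_sum: "direct_sum R S T" and normal_sum: "direct_sum R P {v. \<forall>w\<in>T. b v w = 0}"
    and nondeg: "nondegenerate_on b S" "nondegenerate_on b P"
    and L_orth: "orthogonal_sets b L S" "orthogonal_sets b L P"
    and R_frame: "\<And>i. i < r \<Longrightarrow> \<xi> i \<in> R" "\<And>v. v \<in> R \<Longrightarrow> \<exists>a. v = (\<Sum>i<r. a i *\<^sub>R \<xi> i)"
    and L_frame: "\<And>i. i < r \<Longrightarrow> N i \<in> L" "\<And>v. v \<in> L \<Longrightarrow> \<exists>a. v = (\<Sum>i<r. a i *\<^sub>R N i)"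
    and pairing: "\<And>i j. i < r \<Longrightarrow> j < r \<Longrightarrow> b (\<xi> i) (N j) = (if i = j then 1 else 0)"
    and L_null: "\<And>i j. i < r \<Longrightarrow> j < r \<Longrightarrow> b (N i) (N j) = 0"
begin

lemma linear_left: "linear (\<lambda>v. b v w)" and linear_right: "linear (\<lambda>w. b v w)"
  using b by (simp_all add: bilinear_def)

lemmas b_simps = linear_add[OF linear_left] linear_diff[OF linear_left] linear_cmul[OF linear_left]
  linear_sum[OF linear_left] linear_add[OF linear_right] linear_cmul[OF linear_right]
  linear_sum[OF linear_right] linear_0[OF linear_left] linear_0[OF linear_right]

lemma S_sub_T: "S \<subseteq> T"
  using direct_sum_right[OF T_sum] by blast

lemma P_orth_T: "s \<in> P \<Longrightarrow> t \<in> T \<Longrightarrow> b s t = 0"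
  using direct_sum_right[OF normal_sum] by blast

lemma L_isotropic: "n \<in> L \<Longrightarrow> n' \<in> L \<Longrightarrow> b n n' = 0"
proof -
  assume "n \<in> L" "n' \<in> L"
  then obtain a a' where "n = (\<Sum>i<r. a i *\<^sub>R N i)" "n' = (\<Sum>i<r. a' i *\<^sub>R N i)"
    using L_frame(2) by meson
  then show ?thesis by (simp add: b_simps L_null)
qed

text \<open>
  Subtract from \<open>v\<close> its projections to \<open>S\<close> and \<open>P\<close> and the vector of \<open>L\<close> that has the same pairings with the
  radical. The remainder is orthogonal to \<open>R\<close>, \<open>S\<close> and \<open>P\<close>, hence is a normal vector
  orthogonal to \<open>P\<close>, that is, a vector of the radical.
\<close>

lemma decomposition:
  obtains t l s where "t \<in> T" "l \<in> L" "s \<in> P" "v = t + l + s"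
proof -
  obtain s1 where s1: "s1 \<in> S" "\<forall>w\<in>S. b (v - s1) w = 0"
    using nondegenerate_projection[OF b subspaces(2) nondeg(1), of v] by blast
  obtain s2 where s2: "s2 \<in> P" "\<forall>w\<in>P. b (v - s2) w = 0"
    using nondegenerate_projection[OF b subspaces(3) nondeg(2), of v] by blast
  define l where "l = (\<Sum>i<r. b v (\<xi> i) *\<^sub>R N i)"
  have l: "l \<in> L" unfolding l_def using subspaces(4) L_frame(1) by (auto intro!: subspace_sum subspace_scale)
  have R_T: "R \<subseteq> T" and R_orth: "\<And>w t. w \<in> R \<Longrightarrow> t \<in> T \<Longrightarrow> b w t = 0" using R by auto
  define v' where "v' = v - s1 - s2 - l"
  have v'_S: "b v' w = 0" if "w \<in> S" for w
    using bspec[OF s1(2) that] P_orth_T[OF s2(1)] S_sub_T that L_orth(1) l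
    by (auto simp: v'_def b_simps orthogonal_sets_def)
  have v'_P: "b v' w = 0" if "w \<in> P" for w
    using bspec[OF s2(2) that] P_orth_T[OF that, of s1] sym[of w s1] S_sub_T s1(1) that L_orth(2) l
    by (auto simp: v'_def b_simps orthogonal_sets_def)
  have v'_\<xi>: "b v' (\<xi> i) = 0" if "i < r" for i
  proof -
    have "\<xi> i \<in> R" using that by (rule R_frame(1))
    then have "b s1 (\<xi> i) = 0" "b s2 (\<xi> i) = 0"
      using R_orth[of "\<xi> i" s1] sym[of s1] S_sub_T s1(1) P_orth_T[OF s2(1)] R_T by auto
    moreover have "b l (\<xi> i) = b v (\<xi> i)"
    proof -
      have "b l (\<xi> i) = (\<Sum>j<r. if i = j then b v (\<xi> j) else 0)"
        unfolding l_def b_simps using pairing[OF that] sym by (intro sum.cong) auto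
      then show ?thesis using that by simp
    qed
    ultimately show ?thesis by (simp add: v'_def b_simps)
  qed
  have "b v' w = 0" if "w \<in> T" for w
  proof -
    have "w \<in> {u + v |u v. u \<in> R \<and> v \<in> S}" using T_sum \<open>w \<in> T\<close> by (simp add: direct_sum_def)
    then obtain \<rho> \<sigma> where w: "w = \<rho> + \<sigma>" "\<rho> \<in> R" "\<sigma> \<in> S" by blast
    obtain a where "\<rho> = (\<Sum>i<r. a i *\<^sub>R \<xi> i)" using R_frame(2)[OF w(2)] by blast
    then show ?thesis using w v'_S v'_\<xi> by (simp add: b_simps)
  qed
  then have "v' \<in> {u + v |u v. u \<in> R \<and> v \<in> P}" using normal_sum by (simp add: direct_sum_def)
  then obtain \<rho> \<pi> where v': "v' = \<rho> + \<pi>" "\<rho> \<in> R" "\<pi> \<in> P" by blast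
  have "b \<pi> w = 0" if "w \<in> P" for w
    using v'_P[OF that] v' P_orth_T[OF that, of \<rho>] sym[of w \<rho>] R_T by (auto simp: b_simps)
  then have "\<pi> = 0" using nondeg(2) v'(3) by (auto simp: nondegenerate_on_def)
  then have "v = (s1 + \<rho>) + l + s2" using v'(1) by (simp add: v'_def algebra_simps)
  moreover have "s1 + \<rho> \<in> T" using s1(1) S_sub_T v'(2) R_T subspaces(1) by (auto intro: subspace_add)
  ultimately show ?thesis using that l s2(1) by blast
qed

text \<open>
  In a vanishing sum, the part in \<open>L\<close> is killed by pairing with the radical, to which \<open>T\<close> and \<open>P\<close> are
  orthogonal; the other two parts are then opposite vectors of \<open>R \<inter> P\<close>.
\<close>

lemma decomposition_unique:
  assumes "t \<in> T" "l \<in> L" "s \<in> P" "t' \<in> T" "l' \<in> L" "s' \<in> P" "t + l + s = t' + l' + s'"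
  shows "t = t'" "l = l'" "s = s'"
proof -
  define t0 where "t0 = t - t'"
  define l0 where "l0 = l - l'"
  define s0 where "s0 = s - s'"
  have m: "t0 \<in> T" "l0 \<in> L" "s0 \<in> P"
    using assms subspaces by (auto simp: t0_def l0_def s0_def subspace_diff)
  have eq: "t0 + l0 + s0 = 0" using assms(7) by (simp add: t0_def l0_def s0_def algebra_simps)
  obtain a where a: "l0 = (\<Sum>i<r. a i *\<^sub>R N i)" using L_frame(2)[OF m(2)] by blast
  have "a i = 0" if "i < r" for i
  proof -
    have \<xi>: "\<xi> i \<in> R" using that by (rule R_frame(1))
    have "b (\<xi> i) l0 = (\<Sum>j<r. if i = j then a j else 0)"
      unfolding a b_simps using pairing[OF that] by (intro sum.cong) auto
    also have "\<dots> = a i" using that by simp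
    finally have "a i = b (\<xi> i) (t0 + l0 + s0)"
      using \<xi> R m sym[of "\<xi> i" s0] P_orth_T[OF m(3), of "\<xi> i"] by (simp add: b_simps)
    then show ?thesis by (simp add: eq b_simps)
  qed
  then have l0: "l0 = 0" by (simp add: a)
  with eq have t0: "t0 = - s0" by (simp add: eq_neg_iff_add_eq_0)
  then have "s0 \<in> T" using m(1) subspaces(1) by (metis minus_minus subspace_neg)
  then have "s0 \<in> R \<inter> P" using m(3) P_orth_T[OF m(3)] by (auto simp: R)
  then have "s0 = 0" using normal_sum by (auto simp: direct_sum_def)
  with t0 l0 show "t = t'" "l = l'" "s = s'" by (simp_all add: t0_def l0_def s0_def)
qed

lemma mem_screen_iff:
  assumes "t \<in> T"
  shows "t \<in> S \<longleftrightarrow> (\<forall>n\<in>L. b t n = 0)"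
proof
  show "\<forall>n\<in>L. b t n = 0" if "t \<in> S"
    using that L_orth(1) sym by (metis orthogonal_sets_def)
next
  assume t_L: "\<forall>n\<in>L. b t n = 0"
  have "t \<in> {u + v |u v. u \<in> R \<and> v \<in> S}" using T_sum assms by (simp add: direct_sum_def)
  then obtain \<rho> \<sigma> where t: "t = \<rho> + \<sigma>" "\<rho> \<in> R" "\<sigma> \<in> S" by blast
  obtain a where a: "\<rho> = (\<Sum>i<r. a i *\<^sub>R \<xi> i)" using R_frame(2)[OF t(2)] by blast
  have "a j = 0" if "j < r" for j
  proof -
    have "b \<rho> (N j) = (\<Sum>i<r. if i = j then a i else 0)"
      unfolding a b_simps using pairing[OF _ that] by (intro sum.cong) auto
    also have "\<dots> = a j" using that by simp
    finally have "a j = b \<rho> (N j)" ..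
    also have "\<dots> = b t (N j) - b \<sigma> (N j)" by (simp add: t(1) b_simps)
    also have "\<dots> = 0"
      using t_L L_frame(1)[OF that] t(3) L_orth(1) sym[of \<sigma> "N j"]
      by (simp add: orthogonal_sets_def)
    finally show ?thesis .
  qed
  then show "t \<in> S" using t by (simp add: a)
qed

end

section \<open>Components of the ambient derivative\<close>

lemma lightlike_splitting_at:
  fixes B :: "('b::{t2_space, second_countable_topology}, 'f::euclidean_space) atlas"
    and A :: "('a::{t2_space, second_countable_topology}, 'e::euclidean_space) atlas"
  assumes "smooth_atlas A" and g: "semi_riemannian_metric A g"
    and N: "lightlike_submanifold B A \<iota> g r"
    and S: "screen_distribution B A \<iota> g S"
    and P: "screen_transversal_bundle B A \<iota> g P"
    and L: "lightlike_transversal_bundle B A \<iota> g r S P L"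
  obtains \<xi> N where "lightlike_splitting (g (\<iota> x)) (tangent_bundle B A \<iota> x) (radical B A \<iota> g x)
    (S x) (P x) (L x) r \<xi> N"
proof -
  have "smooth_subbundle B A \<iota> r (radical B A \<iota> g)"
    using N by (simp only: lightlike_submanifold_def)
  then obtain V \<xi> where V: "open V" "x \<in> V" and \<xi>: "local_frame B A \<iota> r (radical B A \<iota> g) V \<xi>"
    unfolding smooth_subbundle_def by metis
  from L[unfolded lightlike_transversal_bundle_def, THEN conjunct2, THEN conjunct2,
      rule_format, OF V(1) \<xi> V(2)]
  obtain V' N' where "open V'" and V': "x \<in> V'" and "V' \<subseteq> V" and N': "local_frame B A \<iota> r L V' N'"
    and pairing: "\<forall>y\<in>V'. \<forall>i<r. \<forall>j<r. g (\<iota> y) (\<xi> i y) (N' j y) = (if i = j then 1 else 0) \<and>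
      g (\<iota> y) (N' i y) (N' j y) = 0"
    by (elim exE conjE) (rule that)
  have imm: "smooth_atlas B" "smooth_map B A \<iota>"
    using N by (auto simp: lightlike_submanifold_def immersed_submanifold_def)
  have "linear (differential B A \<iota> x)"
    using smooth_map_has_derivative[OF imm(1) assms(1) imm(2)] by (rule has_derivative_linear)
  then have T: "subspace (tangent_bundle B A \<iota> x)"
    unfolding tangent_bundle_def by (intro linear_subspace_image) auto
  have "lightlike_splitting (g (\<iota> x)) (tangent_bundle B A \<iota> x) (radical B A \<iota> g x)
    (S x) (P x) (L x) r (\<lambda>i. \<xi> i x) (\<lambda>i. N' i x)"
  proof
    show "bilinear (g (\<iota> x))" "\<And>v w. g (\<iota> x) v w = g (\<iota> x) w v"
      using g by (auto simp: semi_riemannian_metric_def)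
    show "subspace (S x)" "subspace (P x)" "subspace (L x)"
      using S P L unfolding screen_distribution_def screen_transversal_bundle_def
        lightlike_transversal_bundle_def by (auto intro: subspace_subbundle)
    show "radical B A \<iota> g x = tangent_bundle B A \<iota> x \<inter>
        {v. \<forall>w\<in>tangent_bundle B A \<iota> x. g (\<iota> x) v w = 0}"
      by (simp add: radical_def normal_bundle_def)
    show "direct_sum (radical B A \<iota> g x) (S x) (tangent_bundle B A \<iota> x)"
      "nondegenerate_on (g (\<iota> x)) (S x)"
      using S by (auto simp: screen_distribution_def)
    show "direct_sum (radical B A \<iota> g x) (P x) {v. \<forall>w\<in>tangent_bundle B A \<iota> x. g (\<iota> x) v w = 0}"
      "nondegenerate_on (g (\<iota> x)) (P x)"
      using P by (auto simp: screen_transversal_bundle_def normal_bundle_def)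
    show "orthogonal_sets (g (\<iota> x)) (L x) (S x)" "orthogonal_sets (g (\<iota> x)) (L x) (P x)"
      using L by (auto simp: lightlike_transversal_bundle_def)
    show "\<xi> i x \<in> radical B A \<iota> g x" "N' i x \<in> L x" if "i < r" for i
      using local_frame_mem[OF \<xi> V(2) that] local_frame_mem[OF N' V' that] by auto
    show "\<exists>a. v = (\<Sum>i<r. a i *\<^sub>R \<xi> i x)" if "v \<in> radical B A \<iota> g x" for v
      by (rule local_frame_expansion[OF \<xi> V(2) that]) blast
    show "\<exists>a. v = (\<Sum>i<r. a i *\<^sub>R N' i x)" if "v \<in> L x" for v
      by (rule local_frame_expansion[OF N' V' that]) blast
    show "g (\<iota> x) (\<xi> i x) (N' j x) = (if i = j then 1 else 0)" "g (\<iota> x) (N' i x) (N' j x) = 0"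
      if "i < r" "j < r" for i j using pairing V' that by auto
  qed (rule T)
  then show ?thesis by (rule that)
qed

text \<open>
  The bundles \<open>LL\<close> and \<open>PP\<close> are those whose fibres at \<open>x\<close> are \<open>L\<close> and \<open>P\<close>.
\<close>

lemma (in lightlike_splitting) gauss_components:
  assumes X: "conn_along B A \<iota> D W U x = t + l + s" "t \<in> T" "l \<in> L" "s \<in> P"
    and fibres: "T = tangent_bundle B A \<iota> x" "L = LL x" "P = PP x"
  shows "induced_conn B A \<iota> D LL PP W U x = t" "h_screen B A \<iota> D LL PP W U x = s"
proof -
  show "induced_conn B A \<iota> D LL PP W U x = t"
    unfolding induced_conn_def fibres[symmetric]
  proof (rule the_equality)
    show "t \<in> T \<and> (\<exists>l\<in>L. \<exists>s\<in>P. conn_along B A \<iota> D W U x = t + l + s)"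
      using X by (intro conjI bexI[of _ l] bexI[of _ s]) simp_all
    fix t' assume "t' \<in> T \<and> (\<exists>l\<in>L. \<exists>s\<in>P. conn_along B A \<iota> D W U x = t' + l + s)"
    then obtain l' s' where Y: "t' \<in> T" "l' \<in> L" "s' \<in> P" "conn_along B A \<iota> D W U x = t' + l' + s'"
      by (elim conjE bexE) (rule that)
    show "t' = t" by (rule decomposition_unique(1)[OF Y(1-3) X(2-4) trans[OF Y(4)[symmetric] X(1)]])
  qed
  show "h_screen B A \<iota> D LL PP W U x = s"
    unfolding h_screen_def fibres[symmetric]
  proof (rule the_equality)
    show "s \<in> P \<and> (\<exists>t\<in>T. \<exists>l\<in>L. conn_along B A \<iota> D W U x = t + l + s)"
      using X by (intro conjI bexI[of _ t] bexI[of _ l]) simp_all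
    fix s' assume "s' \<in> P \<and> (\<exists>t\<in>T. \<exists>l\<in>L. conn_along B A \<iota> D W U x = t + l + s')"
    then obtain t' l' where Y: "t' \<in> T" "l' \<in> L" "s' \<in> P" "conn_along B A \<iota> D W U x = t' + l' + s'"
      by (elim conjE bexE) (rule that)
    show "s' = s" by (rule decomposition_unique(3)[OF Y(1-3) X(2-4) trans[OF Y(4)[symmetric] X(1)]])
  qed
qed

text \<open>
  The identity \<open>g (h\<^sup>s(W, J U) - p h\<^sup>s(W, U), J n) = q g (t, n)\<close>, with \<open>t\<close> the tangential part of the
  ambient derivative of \<open>U\<close>.
\<close>

lemma screen_component_pairing:
  fixes B :: "('b::{t2_space, second_countable_topology}, 'f::euclidean_space) atlas"
    and A :: "('a::{t2_space, second_countable_topology}, 'e::euclidean_space) atlas"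
  assumes M: "locally_metallic_manifold p q A g J D"
    and sub: "lightlike_submanifold B A \<iota> g r"
    and S: "screen_distribution B A \<iota> g S"
    and P: "screen_transversal_bundle B A \<iota> g P"
    and L: "lightlike_transversal_bundle B A \<iota> g r S P L"
    and J_L: "J (\<iota> x) ` L x \<subseteq> P x"
    and W: "W x \<in> tangent_bundle B A \<iota> x" and U: "U \<in> sections_along B A \<iota> UNIV" and n: "n \<in> L x"
  shows "g (\<iota> x) (h_screen B A \<iota> D L P W (\<lambda>y. J (\<iota> y) (U y)) x
      - real p *\<^sub>R h_screen B A \<iota> D L P W U x) (J (\<iota> x) n) =
    real q * g (\<iota> x) (induced_conn B A \<iota> D L P W U x) n"
proof -
  have A: "smooth_atlas A" and g: "semi_riemannian_metric A g" and J: "smooth_endomorphism_field A J"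
    and JJ: "\<And>x v. J x (J x v) = real p *\<^sub>R J x v + real q *\<^sub>R v"
    and J_adj: "\<And>x v w. g x (J x v) w = g x v (J x w)"
    and D: "affine_connection A D" and par: "parallel_endomorphism A D J"
    using M by (auto simp: locally_metallic_manifold_def metallic_manifold_def levi_civita_def)
  have B: "smooth_atlas B" and \<iota>: "smooth_map B A \<iota>"
    using sub by (auto simp: lightlike_submanifold_def immersed_submanifold_def)
  obtain \<xi> N where "lightlike_splitting (g (\<iota> x)) (tangent_bundle B A \<iota> x) (radical B A \<iota> g x)
      (S x) (P x) (L x) r \<xi> N"
    by (rule lightlike_splitting_at[OF A g sub S P L])
  then interpret lightlike_splitting "g (\<iota> x)" "tangent_bundle B A \<iota> x" "radical B A \<iota> g x"
    "S x" "P x" "L x" r \<xi> N .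
  let ?b = "g (\<iota> x)" and ?J = "J (\<iota> x)"
  define X where "X = conn_along B A \<iota> D W U x"
  obtain t l s where X: "t \<in> tangent_bundle B A \<iota> x" "l \<in> L x" "s \<in> P x" "X = t + l + s"
    by (rule decomposition)
  obtain t' l' s' where X': "t' \<in> tangent_bundle B A \<iota> x" "l' \<in> L x" "s' \<in> P x" "?J X = t' + l' + s'"
    by (rule decomposition)
  have comps: "induced_conn B A \<iota> D L P W U x = t" "h_screen B A \<iota> D L P W U x = s"
    by (rule gauss_components[where LL = L and PP = P,
          OF X(4)[unfolded X_def] X(1-3) refl refl refl])+
  have JX: "conn_along B A \<iota> D W (\<lambda>y. J (\<iota> y) (U y)) x = ?J X"
    unfolding X_def by (rule conn_along_endomorphism[where W = W and x = x, OF B A \<iota> D J par U W])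
  have comps': "h_screen B A \<iota> D L P W (\<lambda>y. J (\<iota> y) (U y)) x = s'"
    by (rule gauss_components(2)[where LL = L and PP = P,
          OF JX[unfolded X'(4)] X'(1-3) refl refl refl])
  have Jn: "?J n \<in> P x" using J_L n by auto
  have L_P: "?b v w = 0" "?b w v = 0" if "v \<in> L x" "w \<in> P x" for v w
    using L_orth(2) that sym[of w v] by (auto simp: orthogonal_sets_def)
  have T_P: "?b v w = 0" if "v \<in> tangent_bundle B A \<iota> x" "w \<in> P x" for v w
    using P_orth_T that sym[of v w] by auto
  have "?b s' (?J n) = ?b (?J X) (?J n)"
    unfolding X'(4) using X'(1-3) Jn by (simp add: b_simps L_P T_P)
  also have "\<dots> = ?b (?J (?J X)) n" by (rule J_adj[symmetric])
  also have "\<dots> = real p * ?b X (?J n) + real q * ?b X n" by (simp add: JJ b_simps J_adj)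
  also have "?b X (?J n) = ?b s (?J n)"
    unfolding X(4) using X(1-3) Jn by (simp add: b_simps L_P T_P)
  also have "?b X n = ?b t n"
    unfolding X(4) using X(1-3) n by (simp add: b_simps L_P L_isotropic)
  finally show ?thesis by (simp add: comps comps' b_simps)
qed

section \<open>Totally geodesic screen distributions\<close>

theorem theorem3p16:
  fixes p q r :: nat
    and A :: "('a::{t2_space, second_countable_topology}, 'e::euclidean_space) atlas"
    and B :: "('b::{t2_space, second_countable_topology}, 'f::euclidean_space) atlas"
    and g :: "'a \<Rightarrow> 'e \<Rightarrow> 'e \<Rightarrow> real"
    and J :: "'a \<Rightarrow> 'e \<Rightarrow> 'e"
    and D :: "('a, 'e) connection"
    and \<iota> :: "'b \<Rightarrow> 'a"
    and S P L :: "'b \<Rightarrow> 'e set"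
  assumes "p > 0" and "q > 0"
    and "locally_metallic_manifold p q A g J D"
    and "lightlike_submanifold B A \<iota> g r"
    and "screen_distribution B A \<iota> g S"
    and "screen_transversal_bundle B A \<iota> g P"
    and "lightlike_transversal_bundle B A \<iota> g r S P L"
    and "radical_screen_transversal B A \<iota> g J S P"
    and "screen_transversal_splitting B A \<iota> g J L P"
  shows "totally_geodesic_screen B A \<iota> D S L P \<longleftrightarrow>
    (\<forall>W\<in>sections B A \<iota> S. \<forall>U\<in>sections B A \<iota> S.
       no_component_in_J_ltr B A \<iota> g J L
         (\<lambda>x. h_screen B A \<iota> D L P W (\<lambda>y. J (\<iota> y) (U y)) x
              - real p *\<^sub>R h_screen B A \<iota> D L P W U x))"
proof -
  have A: "smooth_atlas A" and g: "semi_riemannian_metric A g"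
    using assms(3) by (auto simp: locally_metallic_manifold_def metallic_manifold_def)
  have B: "smooth_atlas B" and \<iota>: "continuous_on UNIV \<iota>"
    using assms(4) by (auto simp: lightlike_submanifold_def immersed_submanifold_def smooth_map_def)
  have L: "smooth_subbundle B A \<iota> r L"
    using assms(7) by (simp add: lightlike_transversal_bundle_def)
  have equiv: "(\<forall>x. induced_conn B A \<iota> D L P W U x \<in> S x) \<longleftrightarrow>
      no_component_in_J_ltr B A \<iota> g J L
         (\<lambda>x. h_screen B A \<iota> D L P W (\<lambda>y. J (\<iota> y) (U y)) x
              - real p *\<^sub>R h_screen B A \<iota> D L P W U x)"
    if W: "W \<in> sections B A \<iota> S" and U: "U \<in> sections B A \<iota> S" for W U
  proof -
    have S_T: "S x \<subseteq> tangent_bundle B A \<iota> x" for x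
      by (rule lightlike_splitting_at[OF A g assms(4-7), of x]) (rule lightlike_splitting.S_sub_T)
    have "W x \<in> S x" for x using W by (simp add: sections_def)
    then have W_T: "W x \<in> tangent_bundle B A \<iota> x" for x by (rule subsetD[OF S_T])
    have J_L: "J (\<iota> x) ` L x \<subseteq> P x" for x
      using assms(9) by (simp add: screen_transversal_splitting_def)
    have U': "U \<in> sections_along B A \<iota> UNIV" using U by (simp add: sections_def)
    have pairing: "g (\<iota> x) (h_screen B A \<iota> D L P W (\<lambda>y. J (\<iota> y) (U y)) x
        - real p *\<^sub>R h_screen B A \<iota> D L P W U x) (J (\<iota> x) n) =
        real q * g (\<iota> x) (induced_conn B A \<iota> D L P W U x) n" if "n \<in> L x" for x n
      by (rule screen_component_pairing[where W = W and x = x, OF assms(3-7) J_L W_T U' that])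
    have mem: "induced_conn B A \<iota> D L P W U x \<in> S x \<longleftrightarrow>
        (\<forall>n\<in>L x. g (\<iota> x) (induced_conn B A \<iota> D L P W U x) n = 0)" for x
    proof (rule lightlike_splitting_at[OF A g assms(4-7), of x])
      fix \<xi> N assume "lightlike_splitting (g (\<iota> x)) (tangent_bundle B A \<iota> x) (radical B A \<iota> g x)
        (S x) (P x) (L x) r \<xi> N"
      then interpret lightlike_splitting "g (\<iota> x)" "tangent_bundle B A \<iota> x" "radical B A \<iota> g x"
        "S x" "P x" "L x" r \<xi> N .
      obtain t l s where X: "t \<in> tangent_bundle B A \<iota> x" "l \<in> L x" "s \<in> P x"
        "conn_along B A \<iota> D W U x = t + l + s"
        by (rule decomposition)
      have "induced_conn B A \<iota> D L P W U x = t"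
        by (rule gauss_components(1)[where LL = L and PP = P, OF X(4,1-3) refl refl refl])
      then show ?thesis using mem_screen_iff X(1) by simp
    qed
    \<comment> \<open>Orthogonality to all vectors of \<open>L\<close> can be tested on global sections of \<open>L\<close>.\<close>
    have "(\<forall>x. \<forall>n\<in>L x. g (\<iota> x) (induced_conn B A \<iota> D L P W U x) n = 0) \<longleftrightarrow>
        (\<forall>N\<in>sections B A \<iota> L. \<forall>x. g (\<iota> x) (induced_conn B A \<iota> D L P W U x) (N x) = 0)"
    proof (intro iffI allI ballI)
      fix N x assume "\<forall>x. \<forall>n\<in>L x. g (\<iota> x) (induced_conn B A \<iota> D L P W U x) n = 0"
        and "N \<in> sections B A \<iota> L"
      then show "g (\<iota> x) (induced_conn B A \<iota> D L P W U x) (N x) = 0" by (simp add: sections_def)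
    next
      fix x n assume *: "\<forall>N\<in>sections B A \<iota> L. \<forall>x. g (\<iota> x) (induced_conn B A \<iota> D L P W U x) (N x) = 0"
        and n: "n \<in> L x"
      obtain N where N: "N \<in> sections B A \<iota> L" "N x = n"
        by (rule section_through_vector[OF B A \<iota> L n])
      show "g (\<iota> x) (induced_conn B A \<iota> D L P W U x) n = 0"
        using bspec[OF * N(1), THEN spec, of x] by (simp only: N(2))
    qed
    moreover have "no_component_in_J_ltr B A \<iota> g J L
         (\<lambda>x. h_screen B A \<iota> D L P W (\<lambda>y. J (\<iota> y) (U y)) x
              - real p *\<^sub>R h_screen B A \<iota> D L P W U x) \<longleftrightarrow>
        (\<forall>N\<in>sections B A \<iota> L. \<forall>x. g (\<iota> x) (induced_conn B A \<iota> D L P W U x) (N x) = 0)"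
      unfolding no_component_in_J_ltr_def
    proof (rule ball_cong[OF refl])
      fix N assume "N \<in> sections B A \<iota> L"
      then have "N x \<in> L x" for x by (simp add: sections_def)
      then show "(\<forall>x. g (\<iota> x) (h_screen B A \<iota> D L P W (\<lambda>y. J (\<iota> y) (U y)) x
            - real p *\<^sub>R h_screen B A \<iota> D L P W U x) (J (\<iota> x) (N x)) = 0) \<longleftrightarrow>
          (\<forall>x. g (\<iota> x) (induced_conn B A \<iota> D L P W U x) (N x) = 0)"
        using \<open>q > 0\<close> by (simp add: pairing)
    qed
    ultimately show ?thesis by (simp only: mem)
  qed
  show ?thesis
    unfolding totally_geodesic_screen_def by (intro ball_cong refl) (rule equiv)
qed

end
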